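(* Let $\mathbf{r}=\{r_k\}_{k\ge1}$ be a rising to infinity sequence of real numbers, and let $M(\mathbf{r})=\{(n,r_k) : n,k\in\mathbb{Z},\ k\ge1\}\subset\mathbb{R}^2$. Then: (1) If $\mathbf{r}$ is lacunary, i.e. $\liminf_{k\to\infty}\frac{r_{k+1}}{r_k}>1$, then $\dim_{\mathrm H}(\mathrm{E}(M(\mathbf{r})))=1$. (2) If $\mathbf{r}$ is sublacunary, i.e. $\lim_{k\to\infty}\frac{r_{k+1}}{r_k}=1$, then $\dim_{\mathrm H}(\mathrm{E}(M(\mathbf{r})))=0$. (3) If $\limsup_{k\to\infty}(r_{k+1}-r_k)<\infty$, then the set $\mathrm{E}(M(\mathbf{r}))$ is at most countable.
   Context: A sequence $\{r_k\}_{k\ge1}$ of real numbers is called rising to infinity if it is strictly increasing and $\lim_{k\to\infty}r_k=\infty$. A set $A\subset\mathbb{R}$ is called discrete if $A\cap[-r,r]$ is finite for every $r>0$. Let $\mathbb{T}=[0,2\pi)$, and for $\alpha\in\mathbb{T}$ define $\Phi_\alpha:\mathbb{R}^2\to\mathbb{R}$ by $\Phi_\alpha(x_1,x_2)=x_1\cos\alpha+x_2\sin\alpha$. For $M\subset\mathbb{R}^2$ put $\mathrm{DEN}(M)=\{\alpha\in\mathbb{T} : \Phi_\alpha(M)\text{ is dense in }\mathbb{R}\}$, $\mathrm{DIS}(M)=\{\alpha\in\mathbb{T} : \Phi_\alpha(M)\text{ is a discrete subset of }\mathbb{R}\}$, and $\mathrm{E}(M)=\mathbb{T}\setminus(\mathrm{DEN}(M)\cup\mathrm{DIS}(M))$.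 Here $\dim_{\mathrm H}$ denotes Hausdorff dimension. *)

theory Defs
  imports "HOL-Analysis.Analysis"
begin

text \<open>
  The cost of a bounded set \<open>U\<close> in an \<open>s\<close>-dimensional cover is \<open>(diam U)\<^sup>s\<close>, where \<open>0\<^sup>0 = 1\<close> for
  nonempty \<open>U\<close> and the empty set costs nothing for every \<open>s\<close>. The case distinction is needed
  because \<open>0 powr 0 = 0\<close> in HOL.
\<close>

definition diam_cost :: "real \<Rightarrow> 'a::metric_space set \<Rightarrow> ennreal" where
  "diam_cost s U =
     (if U = {} then 0 else if s = 0 then 1 else ennreal (diameter U powr s))"

text \<open>
  Boundedness of the covering sets is demanded explicitly, as \<^const>\<open>diameter\<close> carries no
  information about unbounded sets. Covers are countable; finite ones are padded with empty sets.
\<close>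

definition hausdorff_pre_measure :: "real \<Rightarrow> real \<Rightarrow> 'a::metric_space set \<Rightarrow> ennreal" where
  "hausdorff_pre_measure s \<delta> A =
     (INF U\<in>{U :: nat \<Rightarrow> 'a set. A \<subseteq> (\<Union>i. U i) \<and> (\<forall>i. bounded (U i) \<and> diameter (U i) \<le> \<delta>)}.
        \<Sum>i. diam_cost s (U i))"

definition hausdorff_measure :: "real \<Rightarrow> 'a::metric_space set \<Rightarrow> ennreal" where
  "hausdorff_measure s A = (SUP \<delta>\<in>{0<..}. hausdorff_pre_measure s \<delta> A)"

text \<open>The value is \<open>\<infinity>\<close> if no \<open>s\<close> qualifies; the empty set has dimension \<open>0\<close>.\<close>

definition hausdorff_dim :: "'a::metric_space set \<Rightarrow> ennreal" where
  "hausdorff_dim A = (INF s\<in>{s. 0 \<le> s \<and> hausdorff_measure s A = 0}. ennreal s)"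

text \<open>Sequences are indexed from 1; the value at index 0 is irrelevant throughout.\<close>

definition rising_to_infinity :: "(nat \<Rightarrow> real) \<Rightarrow> bool" where
  "rising_to_infinity r \<longleftrightarrow> strict_mono_on {1..} r \<and> filterlim r at_top sequentially"

definition lacunary :: "(nat \<Rightarrow> real) \<Rightarrow> bool" where
  "lacunary r \<longleftrightarrow> liminf (\<lambda>k. ereal (r (k + 1) / r k)) > 1"

definition sublacunary :: "(nat \<Rightarrow> real) \<Rightarrow> bool" where
  "sublacunary r \<longleftrightarrow> (\<lambda>k. r (k + 1) / r k) \<longlonglongrightarrow> 1"

text \<open>Stronger than topological discreteness: accumulation points outside \<open>A\<close> are excluded too.\<close>

definition discrete_set :: "real set \<Rightarrow> bool" where
  "discrete_set A \<longleftrightarrow> (\<forall>\<rho>>0. finite (A \<inter> {-\<rho>..\<rho>}))"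

definition dense_set :: "real set \<Rightarrow> bool" where
  "dense_set A \<longleftrightarrow> closure A = UNIV"

definition angles :: "real set" where
  "angles = {0..<2 * pi}"

definition \<Phi> :: "real \<Rightarrow> real \<times> real \<Rightarrow> real" where
  "\<Phi> \<alpha> = (\<lambda>(x1, x2). x1 * cos \<alpha> + x2 * sin \<alpha>)"

definition DEN :: "(real \<times> real) set \<Rightarrow> real set" where
  "DEN M = {\<alpha> \<in> angles. dense_set (\<Phi> \<alpha> ` M)}"

definition DIS :: "(real \<times> real) set \<Rightarrow> real set" where
  "DIS M = {\<alpha> \<in> angles. discrete_set (\<Phi> \<alpha> ` M)}"

definition E :: "(real \<times> real) set \<Rightarrow> real set" where
  "E M = angles - (DEN M \<union> DIS M)"

definition M_of :: "(nat \<Rightarrow> real) \<Rightarrow> (real \<times> real) set" where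
  "M_of r = {(real_of_int n, r k) | (n :: int) (k :: nat). k \<ge> 1}"

end

theory Submission
  imports Defs "HOL-Real_Asymp.Real_Asymp"
begin

text \<open>
  With \<open>t = tan \<alpha>\<close>, the projection of the point set is dense iff \<open>r k * t\<close> is dense modulo 1, and
  it is discrete only if two of the numbers \<open>r k * t\<close> coincide modulo 1, which restricts \<open>t\<close> to
  a countable set. So \<open>E\<close> is, up to a countable set, the set of \<open>t\<close> for which \<open>r k * t\<close> avoids an
  arc modulo 1.

  Fix an arc of length \<open>2 / m\<close>. If \<open>m\<close> points \<open>t + d i\<close> with rapidly increasing \<open>\<bar>d i\<bar>\<close> avoid it,
  then \<open>r\<close> has a gap of relative size comparable to \<open>\<bar>d 0\<bar> / \<bar>d (m - 1)\<bar>\<close> near \<open>1 / \<bar>d 0\<bar>\<close>. If the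
  gaps of \<open>r\<close> are bounded, the avoiding set thus has no limit point. If \<open>r\<close> is sublacunary,
  the scales at which an avoiding set branches have density 0, so its box dimension is locally 0.

  If \<open>r\<close> is lacunary, a Cantor set with a large base \<open>2 * M\<close>, in which at least \<open>M\<close> children of
  every interval are kept, avoids a small neighbourhood of 0 modulo 1: in every generation only
  \<open>O(log M)\<close> terms of \<open>r\<close> have to be dealt with. Its dimension tends to 1 as \<open>M\<close> grows.
\<close>

section \<open>Hausdorff null sets\<close>

lemma hausdorff_null_cover:
  assumes "hausdorff_measure s A = 0" "e > 0"
  obtains U :: "nat \<Rightarrow> 'a::metric_space set" where "A \<subseteq> (\<Union>i. U i)"
    "\<And>i. bounded (U i)" "\<And>i. diameter (U i) \<le> e" "(\<Sum>i. diam_cost s (U i)) < ennreal e"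
proof -
  have "hausdorff_pre_measure s e A \<le> hausdorff_measure s A"
    unfolding hausdorff_measure_def using \<open>e > 0\<close> by (intro SUP_upper) auto
  then have "hausdorff_pre_measure s e A < ennreal e"
    using assms by simp
  then show ?thesis
    unfolding hausdorff_pre_measure_def INF_less_iff using that by blast
qed

text \<open>Applying the hypothesis with \<open>min e \<delta>\<close> makes the pre-measure at
  every mesh \<open>\<delta>\<close> at most \<open>e\<close>, so the mesh and the total cost can
  share a single tolerance.\<close>

lemma hausdorff_nullI:
  fixes A :: "'a::metric_space set"
  assumes "\<And>e. e > 0 \<Longrightarrow> \<exists>U :: nat \<Rightarrow> 'a set. A \<subseteq> (\<Union>i. U i) \<and>
      (\<forall>i. bounded (U i) \<and> diameter (U i) \<le> e) \<and> (\<Sum>i. diam_cost s (U i)) \<le> ennreal e"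
  shows "hausdorff_measure s A = 0"
proof -
  have "hausdorff_pre_measure s \<delta> A = 0" if "\<delta> > 0" for \<delta>
  proof -
    have "hausdorff_pre_measure s \<delta> A \<le> 0 + ennreal e" if "e > 0" for e
    proof -
      obtain U :: "nat \<Rightarrow> 'a set" where U: "A \<subseteq> (\<Union>i. U i)"
        "\<forall>i. bounded (U i) \<and> diameter (U i) \<le> min e \<delta>"
        "(\<Sum>i. diam_cost s (U i)) \<le> ennreal (min e \<delta>)"
        using assms[of "min e \<delta>"] \<open>e > 0\<close> \<open>\<delta> > 0\<close> by auto
      have "hausdorff_pre_measure s \<delta> A \<le> (\<Sum>i. diam_cost s (U i))"
        unfolding hausdorff_pre_measure_def using U by (intro INF_lower) auto
      also have "\<dots> \<le> ennreal e"
        using U(3) by (rule order_trans) (auto intro: ennreal_leI)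
      finally show ?thesis by simp
    qed
    then have "hausdorff_pre_measure s \<delta> A \<le> 0"
      by (rule ennreal_le_epsilon)
    then show ?thesis by simp
  qed
  then show ?thesis
    unfolding hausdorff_measure_def by (simp add: SUP_eq_const)
qed

lemma hausdorff_null_finite_coverI:
  fixes A :: "'a::metric_space set"
  assumes "\<And>e. e > 0 \<Longrightarrow> \<exists>n (U :: nat \<Rightarrow> 'a set). A \<subseteq> (\<Union>i<n. U i) \<and>
      (\<forall>i<n. bounded (U i) \<and> diameter (U i) \<le> e) \<and> (\<Sum>i<n. diam_cost s (U i)) \<le> ennreal e"
  shows "hausdorff_measure s A = 0"
proof (rule hausdorff_nullI)
  fix e :: real assume "e > 0"
  then obtain n and U :: "nat \<Rightarrow> 'a set" where U: "A \<subseteq> (\<Union>i<n. U i)"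
    "\<forall>i<n. bounded (U i) \<and> diameter (U i) \<le> e" "(\<Sum>i<n. diam_cost s (U i)) \<le> ennreal e"
    using assms by meson
  define V where "V i = (if i < n then U i else {})" for i
  have "(\<Sum>i. diam_cost s (V i)) = (\<Sum>i<n. diam_cost s (V i))"
    by (intro suminf_finite) (auto simp: V_def diam_cost_def)
  also have "\<dots> = (\<Sum>i<n. diam_cost s (U i))"
    by (simp add: V_def)
  finally have "(\<Sum>i. diam_cost s (V i)) \<le> ennreal e"
    using U(3) by simp
  then show "\<exists>U :: nat \<Rightarrow> 'a set. A \<subseteq> (\<Union>i. U i) \<and>
      (\<forall>i. bounded (U i) \<and> diameter (U i) \<le> e) \<and> (\<Sum>i. diam_cost s (U i)) \<le> ennreal e"
  proof (intro exI[of _ V] conjI allI)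
    show "A \<subseteq> (\<Union>i. V i)"
    proof
      fix x assume "x \<in> A"
      then obtain i where "i < n" "x \<in> U i" using U(1) by blast
      then have "x \<in> V i" by (simp add: V_def)
      then show "x \<in> (\<Union>i. V i)" by blast
    qed
    show "bounded (V i)" "diameter (V i) \<le> e" for i
      using U(2) \<open>e > 0\<close> by (simp_all add: V_def)
  qed
qed

lemma hausdorff_null_subset:
  assumes "hausdorff_measure s B = 0" "A \<subseteq> B"
  shows "hausdorff_measure s A = 0"
proof (rule hausdorff_nullI)
  fix e :: real assume "e > 0"
  obtain U where U: "B \<subseteq> (\<Union>i. U i)"
    "\<And>i. bounded (U i)" "\<And>i. diameter (U i) \<le> e" "(\<Sum>i. diam_cost s (U i)) < ennreal e"
    by (rule hausdorff_null_cover[OF assms(1) \<open>e > 0\<close>]) (rule that)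
  show "\<exists>U. A \<subseteq> (\<Union>i. U i) \<and> (\<forall>i. bounded (U i) \<and> diameter (U i) \<le> e) \<and>
      (\<Sum>i. diam_cost s (U i)) \<le> ennreal e"
    using order_trans[OF assms(2) U(1)] U(2,3) less_imp_le[OF U(4)]
    by (intro exI[of _ U] conjI allI)
qed

text \<open>Give the \<open>n\<close>-th set a cover of cost at most \<open>d n\<close>, where the
  \<open>d n\<close> sum to \<open>e\<close>, and merge the double family into one sequence through
  \<open>prod_decode\<close>.\<close>

lemma hausdorff_null_UN_nat:
  fixes A :: "nat \<Rightarrow> 'a::metric_space set"
  assumes "\<And>n. hausdorff_measure s (A n) = 0"
  shows "hausdorff_measure s (\<Union>n. A n) = 0"
proof (rule hausdorff_nullI)
  fix e :: real assume "e > 0"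
  define d where "d n = e * (1/2) ^ Suc n" for n
  have d: "d n > 0" "d n \<le> e" for n
    using \<open>e > 0\<close> mult_left_mono[OF power_le_one[of "1/2::real" "Suc n"], of e] by (auto simp: d_def)
  have "\<exists>U. A n \<subseteq> (\<Union>i. U i) \<and> (\<forall>i. bounded (U i) \<and> diameter (U i) \<le> d n) \<and>
      (\<Sum>i. diam_cost s (U i)) \<le> ennreal (d n)" for n
  proof -
    obtain U where U: "A n \<subseteq> (\<Union>i. U i)" "\<And>i. bounded (U i)" "\<And>i. diameter (U i) \<le> d n"
        "(\<Sum>i. diam_cost s (U i)) < ennreal (d n)"
      by (rule hausdorff_null_cover[OF assms[of n] d(1)[of n]]) (rule that)
    show ?thesis
      using U(1-3) less_imp_le[OF U(4)] by (intro exI[of _ U] conjI allI)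
  qed
  then obtain U where U: "\<And>n. A n \<subseteq> (\<Union>i. U n i)"
    "\<And>n i. bounded (U n i) \<and> diameter (U n i) \<le> d n"
    "\<And>n. (\<Sum>i. diam_cost s (U n i)) \<le> ennreal (d n)"
    by metis
  define V where "V k = (case prod_decode k of (n, i) \<Rightarrow> U n i)" for k
  have "(\<Sum>k. diam_cost s (V k)) = (\<Sum>k. (\<lambda>(n, i). diam_cost s (U n i)) (prod_decode k))"
    unfolding V_def by (intro arg_cong[where f = suminf]) (auto split: prod.split)
  also have "\<dots> = (\<Sum>n. \<Sum>i. diam_cost s (U n i))"
    by (subst suminf_ennreal_2dimen[where g = "\<lambda>n. \<Sum>i. diam_cost s (U n i)"]) (auto simp: o_def)
  also have "\<dots> \<le> (\<Sum>n. ennreal (d n))"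
    using U(3) by (intro suminf_le) auto
  also have "\<dots> = ennreal e"
  proof -
    have "d = (\<lambda>n. e * (1/2) ^ Suc n)"
      by (simp add: d_def fun_eq_iff)
    then have "d sums e"
      using sums_mult[OF power_half_series, of e] by (simp only: mult_1_right)
    then show ?thesis
      using less_imp_le[OF d(1)] by (intro suminf_ennreal_eq)
  qed
  finally have sum: "(\<Sum>k. diam_cost s (V k)) \<le> ennreal e" .
  have "(\<Union>n. A n) \<subseteq> (\<Union>k. V k)"
  proof
    fix x assume "x \<in> (\<Union>n. A n)"
    then obtain n i where "x \<in> U n i" using U(1) by blast
    then have "x \<in> V (prod_encode (n, i))" by (simp add: V_def)
    then show "x \<in> (\<Union>k. V k)" by blast
  qed
  moreover have "bounded (V k) \<and> diameter (V k) \<le> e" for k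
    using U(2) d(2) by (auto simp: V_def split: prod.split intro: order_trans)
  ultimately show "\<exists>U. (\<Union>n. A n) \<subseteq> (\<Union>i. U i) \<and>
      (\<forall>i. bounded (U i) \<and> diameter (U i) \<le> e) \<and> (\<Sum>i. diam_cost s (U i)) \<le> ennreal e"
    using sum by (intro exI[of _ V] conjI allI) auto
qed

lemma hausdorff_null_empty: "hausdorff_measure s {} = 0"
  by (rule hausdorff_null_finite_coverI) (auto intro!: exI[of _ 0])

lemma hausdorff_null_UN:
  assumes "countable I" "\<And>i. i \<in> I \<Longrightarrow> hausdorff_measure s (A i) = 0"
  shows "hausdorff_measure s (\<Union>i\<in>I. A i) = 0"
proof (cases "I = {}")
  case False
  then have "(\<Union>i\<in>I. A i) = (\<Union>n. A (from_nat_into I n))"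
    by (metis image_image range_from_nat_into[OF False assms(1)])
  then show ?thesis
    using hausdorff_null_UN_nat[of s "\<lambda>n. A (from_nat_into I n)"] assms(2)
      from_nat_into[OF False] by simp
qed (simp add: hausdorff_null_empty)

lemma hausdorff_null_Un:
  assumes "hausdorff_measure s A = 0" "hausdorff_measure s B = 0"
  shows "hausdorff_measure s (A \<union> B) = 0"
  using hausdorff_null_UN[of "{A, B}" s "\<lambda>X. X"] assms by auto

text \<open>A singleton has diameter 0 and hence cost 0. Positivity of \<open>s\<close> matters: for
  \<open>s = 0\<close> it would cost 1.\<close>

lemma hausdorff_null_countable:
  assumes "s > 0" "countable A"
  shows "hausdorff_measure s A = 0"
proof -
  have "hausdorff_measure s {x} = 0" for x :: 'a
    by (rule hausdorff_null_finite_coverI, rule exI[of _ 1], rule exI[of _ "\<lambda>_. {x}"])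
       (use \<open>s > 0\<close> in \<open>auto simp: diam_cost_def\<close>)
  then show ?thesis
    using hausdorff_null_UN[of A s "\<lambda>x. {x}"] assms by simp
qed

text \<open>Images of covering sets have diameter at most \<open>K\<close> times and cost at most
  \<open>K powr s\<close> times the original.\<close>

lemma hausdorff_null_lipschitz_image:
  fixes f :: "'a::metric_space \<Rightarrow> 'b::metric_space"
  assumes "hausdorff_measure s A = 0" "s > 0" "L-lipschitz_on A f"
  shows "hausdorff_measure s (f ` A) = 0"
proof (rule hausdorff_nullI)
  fix e :: real assume "e > 0"
  \<comment> \<open>The Lipschitz constant is raised to at least 1, so that division by it is
    safe.\<close>
  define K where "K = max L 1"
  have K: "K \<ge> 1" "K-lipschitz_on A f"
    using assms(3) by (auto simp: K_def intro: lipschitz_on_mono)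
  define d where "d = min (e / K) (e / K powr s)"
  have d: "d > 0" "K * d \<le> e" "K powr s * d \<le> e"
  proof -
    show "d > 0" using K \<open>e > 0\<close> by (simp add: d_def)
    have "d \<le> e / K" "d \<le> e / K powr s" by (auto simp: d_def)
    then show "K * d \<le> e" "K powr s * d \<le> e"
      using K by (auto simp: field_simps)
  qed
  obtain U where U: "A \<subseteq> (\<Union>i. U i)" "\<And>i. bounded (U i)" "\<And>i. diameter (U i) \<le> d"
      "(\<Sum>i. diam_cost s (U i)) < ennreal d"
    by (rule hausdorff_null_cover[OF assms(1) d(1)]) (rule that)
  \<comment> \<open>Covering sets are cut down to \<open>A\<close>, since \<open>f\<close> is
    controlled only there.\<close>
  define V where "V i = f ` (U i \<inter> A)" for i
  have dist: "dist x y \<le> K * diameter (U i)" if xy: "x \<in> V i" "y \<in> V i" for x y i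
  proof -
    obtain x' y' where "x = f x'" "y = f y'" "x' \<in> U i \<inter> A" "y' \<in> U i \<inter> A"
      using xy by (auto simp: V_def)
    moreover from this have "dist x' y' \<le> diameter (U i)"
      using diameter_bounded_bound U(2) by blast
    then have "K * dist x' y' \<le> K * diameter (U i)"
      using K(1) by (intro mult_left_mono) auto
    ultimately show ?thesis
      using lipschitz_onD[OF K(2), of x' y'] by simp
  qed
  have bd: "bounded (V i)" for i
    using dist unfolding bounded_two_points by blast
  have diam0: "diameter (U i) \<ge> 0" for i
    using U(2) by (rule diameter_ge_0)
  have diam: "diameter (V i) \<le> K * diameter (U i)" for i
  proof (cases "V i = {}")
    case False
    then have "diameter (V i) = (SUP (x, y)\<in>V i \<times> V i. dist x y)"
      by (simp add: diameter_def)
    also have "\<dots> \<le> K * diameter (U i)"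
      using dist False by (intro cSUP_least) auto
    finally show ?thesis .
  qed (use K diam0 in auto)
  have "diam_cost s (V i) \<le> ennreal (K powr s) * diam_cost s (U i)" for i
  proof (cases "V i = {}")
    case False
    then have "U i \<noteq> {}" by (auto simp: V_def)
    have "diameter (V i) powr s \<le> (K * diameter (U i)) powr s"
      using diam diameter_ge_0[OF bd] \<open>s > 0\<close> by (intro powr_mono2) auto
    also have "\<dots> = K powr s * diameter (U i) powr s"
      using K diam0 by (intro powr_mult)
    finally show ?thesis
      using False \<open>U i \<noteq> {}\<close> \<open>s > 0\<close> by (simp add: diam_cost_def ennreal_mult[symmetric])
  qed (simp add: diam_cost_def)
  then have "(\<Sum>i. diam_cost s (V i)) \<le> (\<Sum>i. ennreal (K powr s) * diam_cost s (U i))"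
    by (intro suminf_le) auto
  also have "\<dots> = ennreal (K powr s) * (\<Sum>i. diam_cost s (U i))"
    by simp
  also have "\<dots> \<le> ennreal (K powr s) * ennreal d"
    using U(4) by (intro mult_left_mono) auto
  also have "\<dots> \<le> ennreal e"
    using d by (simp add: ennreal_mult[symmetric] ennreal_leI)
  finally have "(\<Sum>i. diam_cost s (V i)) \<le> ennreal e" .
  moreover have "diameter (V i) \<le> e" for i
    using diam[of i] U(3)[of i] d(2) K(1) mult_left_mono[of "diameter (U i)" d K] by linarith
  moreover have "f ` A \<subseteq> (\<Union>i. V i)"
    unfolding V_def using U(1) by blast
  ultimately show "\<exists>U. f ` A \<subseteq> (\<Union>i. U i) \<and>
      (\<forall>i. bounded (U i) \<and> diameter (U i) \<le> e) \<and> (\<Sum>i. diam_cost s (U i)) \<le> ennreal e"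
    using bd by (intro exI[of _ V] conjI allI)
qed

text \<open>A lower bound for \<open>\<H>\<^sup>s\<close> that needs no measure on the set itself: the inverse of \<open>f\<close> is
  \<open>s\<close>-Hoelder, so a cover of the image by sets of small cost induces a cover of \<open>[0, 1)\<close> of
  Lebesgue measure less than 1.\<close>

lemma hausdorff_measure_expanding_image_nonzero:
  fixes f :: "real \<Rightarrow> 'a::metric_space"
  assumes "s > 0" "C > 0"
    and expand: "\<And>x y. x \<in> {0..<1} \<Longrightarrow> y \<in> {0..<1} \<Longrightarrow> \<bar>x - y\<bar> \<le> C * dist (f x) (f y) powr s"
  shows "hausdorff_measure s (f ` {0..<1}) \<noteq> 0"
proof
  assume null: "hausdorff_measure s (f ` {0..<1}) = 0"
  \<comment> \<open>The preimages lie in intervals of total length at most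
    \<open>2 * C * e = 1 / 2\<close>, too short to cover the unit interval.\<close>
  define e where "e = 1 / (4 * C)"
  have e: "e > 0" using \<open>C > 0\<close> by (simp add: e_def)
  obtain U where U: "f ` {0..<1} \<subseteq> (\<Union>i. U i)" "\<And>i. bounded (U i)" "\<And>i. diameter (U i) \<le> e"
      "(\<Sum>i. diam_cost s (U i)) < ennreal e"
    by (rule hausdorff_null_cover[OF null e]) (rule that)
  have "\<exists>p. \<forall>x\<in>{0..<1}. f x \<in> U i \<longrightarrow> x \<in> cball p (C * diameter (U i) powr s)" for i
  proof (cases "\<exists>p\<in>{0..<1}. f p \<in> U i")
    case True
    then obtain p where p: "p \<in> {0..<1}" "f p \<in> U i" by blast
    have "x \<in> cball p (C * diameter (U i) powr s)" if x: "x \<in> {0..<1}" "f x \<in> U i" for x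
    proof -
      have "dist (f p) (f x) powr s \<le> diameter (U i) powr s"
        using diameter_bounded_bound[OF U(2) p(2) x(2)] \<open>s > 0\<close> by (intro powr_mono2) auto
      then have "C * dist (f p) (f x) powr s \<le> C * diameter (U i) powr s"
        using \<open>C > 0\<close> by (intro mult_left_mono) auto
      then show ?thesis
        using expand[OF p(1) x(1)] by (simp add: dist_real_def)
    qed
    then show ?thesis by blast
  qed blast
  then obtain p where p: "\<And>i x. x \<in> {0..<1} \<Longrightarrow> f x \<in> U i \<Longrightarrow> x \<in> cball (p i) (C * diameter (U i) powr s)"
    by meson
  define V where "V i = (if U i = {} then {} else cball (p i) (C * diameter (U i) powr s))" for i
  have V: "emeasure lborel (V i) = ennreal (2 * C) * diam_cost s (U i)" for i
  proof (cases "U i = {}")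
    case False
    have "V i = {p i - C * diameter (U i) powr s .. p i + C * diameter (U i) powr s}"
      using False by (auto simp: V_def cball_def dist_real_def)
    then have "emeasure lborel (V i) = ennreal (2 * C * diameter (U i) powr s)"
      using \<open>C > 0\<close> by simp
    then show ?thesis
      using False \<open>s > 0\<close> \<open>C > 0\<close> by (simp add: diam_cost_def ennreal_mult[symmetric])
  qed (simp add: V_def diam_cost_def)
  have sets: "V i \<in> sets lborel" for i
    by (simp add: V_def)
  have "{0..<1} \<subseteq> (\<Union>i. V i)"
  proof
    fix x :: real assume x: "x \<in> {0..<1}"
    then obtain i where "f x \<in> U i" using U(1) by blast
    then have "x \<in> V i" using p[OF x] by (auto simp: V_def)
    then show "x \<in> (\<Union>i. V i)" by blast
  qed
  then have "emeasure lborel {0..<1::real} \<le> emeasure lborel (\<Union>i. V i)"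
    using sets by (intro emeasure_mono) auto
  also have "\<dots> \<le> (\<Sum>i. emeasure lborel (V i))"
    using sets by (intro emeasure_subadditive_countably) auto
  also have "\<dots> = ennreal (2 * C) * (\<Sum>i. diam_cost s (U i))"
    by (simp add: V)
  also have "\<dots> \<le> ennreal (2 * C) * ennreal e"
    using U(4) by (intro mult_left_mono) auto
  also have "\<dots> = ennreal (1 / 2)"
    using \<open>C > 0\<close> by (subst ennreal_mult[symmetric]) (auto simp: e_def)
  finally have "ennreal 1 \<le> ennreal (1 / 2)" by simp
  then show False by (subst (asm) ennreal_le_iff) auto
qed

text \<open>About \<open>n\<close> intervals of length \<open>2 * w / n\<close> cover the set, and
  their total cost is of order \<open>n powr (1 - s)\<close>, which tends to 0.\<close>

lemma hausdorff_null_real_bounded: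
  fixes A :: "real set"
  assumes "s > 1" "bounded A"
  shows "hausdorff_measure s A = 0"
proof (rule hausdorff_null_finite_coverI)
  fix e :: real assume "e > 0"
  obtain w where w: "w > 0" "A \<subseteq> {-w..w}"
    using assms(2) unfolding bounded_pos by (metis abs_le_iff atLeastAtMost_iff minus_le_iff
        real_norm_def subsetI)
  have "eventually (\<lambda>n. 2 * w / real n < e) sequentially"
    using \<open>e > 0\<close> by real_asymp
  moreover have "((\<lambda>n. real (Suc n) * (2 * w / real n) powr s) \<longlongrightarrow> 0) sequentially"
    using w(1) \<open>s > 1\<close> by real_asymp
  then have "eventually (\<lambda>n. real (Suc n) * (2 * w / real n) powr s < e) sequentially"
    using \<open>e > 0\<close> by (rule order_tendstoD)
  moreover have "eventually (\<lambda>n. n > 0) sequentially"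
    by (rule eventually_gt_at_top)
  ultimately have "eventually (\<lambda>n. 2 * w / real n < e \<and> real (Suc n) * (2 * w / real n) powr s < e \<and> n > 0)
      sequentially"
    by eventually_elim auto
  then obtain n :: nat where n: "2 * w / real n < e" "real (Suc n) * (2 * w / real n) powr s < e" "n > 0"
    using eventually_happens'[OF sequentially_bot] by blast
  define U where "U i = {-w + real i * (2 * w / n) .. -w + real (Suc i) * (2 * w / n)}" for i
  have len: "-w + real i * (2 * w / n) \<le> -w + real (Suc i) * (2 * w / n)" for i
    using w(1) by (intro add_left_mono mult_right_mono) auto
  have diam: "diameter (U i) = 2 * w / n" for i
  proof -
    have "diameter (U i) = (-w + real (Suc i) * (2 * w / n)) - (-w + real i * (2 * w / n))"
      unfolding U_def diameter_closed_interval by (rule if_not_P) (rule leD[OF len])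
    then show ?thesis by (simp add: distrib_right add_divide_distrib)
  qed
  have ne: "U i \<noteq> {}" for i
    using len[of i] by (simp add: U_def)
  \<comment> \<open>The right end point \<open>w\<close> gets the index \<open>n\<close>, hence
    \<open>Suc n\<close> intervals instead of \<open>n\<close>.\<close>
  have "A \<subseteq> (\<Union>i<Suc n. U i)"
  proof
    fix x assume "x \<in> A"
    then have x: "-w \<le> x" "x \<le> w" using w by auto
    define i where "i = nat \<lfloor>(x + w) * n / (2 * w)\<rfloor>"
    have nn: "(x + w) * n / (2 * w) \<ge> 0" using x w n by simp
    have i: "real i \<le> (x + w) * n / (2 * w)" "(x + w) * n / (2 * w) \<le> real i + 1"
      using nn unfolding i_def by linarith+
    have "(x + w) * n / (2 * w) \<le> n"
      using x w n by (simp add: field_simps)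
    then have "i < Suc n" using i by linarith
    moreover have "x \<in> U i"
      using i w(1) n(3) by (simp add: U_def field_simps)
    ultimately show "x \<in> (\<Union>i<Suc n. U i)" by blast
  qed
  show "\<exists>n (U :: nat \<Rightarrow> real set). A \<subseteq> (\<Union>i<n. U i) \<and>
      (\<forall>i<n. bounded (U i) \<and> diameter (U i) \<le> e) \<and> (\<Sum>i<n. diam_cost s (U i)) \<le> ennreal e"
  proof (intro exI conjI allI impI)
    have "(\<Sum>i<Suc n. diam_cost s (U i)) = (\<Sum>i<Suc n. ennreal ((2 * w / n) powr s))"
      using ne \<open>s > 1\<close> by (simp add: diam_cost_def diam)
    also have "\<dots> = of_nat (Suc n) * ennreal ((2 * w / n) powr s)"
      by (simp only: sum_constant card_lessThan)
    also have "\<dots> = ennreal (real (Suc n) * (2 * w / n) powr s)"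
      by (subst ennreal_mult) (auto simp: ennreal_of_nat_eq_real_of_nat)
    also have "\<dots> \<le> ennreal e"
      using n(2) by (intro ennreal_leI) simp
    finally show "(\<Sum>i<Suc n. diam_cost s (U i)) \<le> ennreal e" .
    show "bounded (U i)" "diameter (U i) \<le> e" for i
      using n(1) diam by (auto simp: U_def)
  qed fact
qed

section \<open>From null measures to the Hausdorff dimension\<close>

lemma hausdorff_dim_le:
  assumes "\<And>t. t > s \<Longrightarrow> hausdorff_measure t A = 0" "s \<ge> 0"
  shows "hausdorff_dim A \<le> ennreal s"
proof -
  have "hausdorff_dim A \<le> ennreal s + ennreal e" if "e > 0" for e
    unfolding hausdorff_dim_def using that assms
    by (subst ennreal_plus[symmetric]) (auto intro!: INF_lower2[of "s + e"] simp del: ennreal_plus)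
  then show ?thesis
    by (rule ennreal_le_epsilon)
qed

text \<open>The exponent 0 lies outside the hypothesis and is treated apart: there every nonempty
  covering set costs 1, so a cover of cost below 1 forces \<open>A = {}\<close>, which is null at
  exponent 1/2 as well.\<close>

lemma hausdorff_dim_ge_1:
  assumes "\<And>t. 0 < t \<Longrightarrow> t < 1 \<Longrightarrow> hausdorff_measure t A \<noteq> 0"
  shows "hausdorff_dim A \<ge> 1"
  unfolding hausdorff_dim_def
proof (rule INF_greatest)
  fix s assume s: "s \<in> {s. 0 \<le> s \<and> hausdorff_measure s A = 0}"
  show "1 \<le> ennreal s"
  proof (rule ccontr)
    assume "\<not> 1 \<le> ennreal s"
    then have "s < 1"
      using s by (simp add: not_le ennreal_less_one_iff)
    then have "s = 0" using s assms[of s] by fastforce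
    then have null: "hausdorff_measure 0 A = 0" using s by simp
    obtain U where U: "A \<subseteq> (\<Union>i. U i)" "(\<Sum>i. diam_cost 0 (U i)) < ennreal 1"
      using hausdorff_null_cover[OF null, of 1] by (metis zero_less_one)
    have "U i = {}" for i
    proof (rule ccontr)
      assume "U i \<noteq> {}"
      then have "1 = (\<Sum>j\<in>{i}. diam_cost 0 (U j))" by (simp add: diam_cost_def)
      also have "\<dots> \<le> (\<Sum>j. diam_cost 0 (U j))"
        by (intro sum_le_suminf) auto
      finally show False using U(2) by simp
    qed
    then have "A = {}" using U(1) by simp
    then show False using assms[of "1/2"] hausdorff_null_empty by auto
  qed
qed

section \<open>Avoiding an arc forces gaps\<close>

text \<open>These are the slopes \<open>t\<close> for which the sequence \<open>r k * t\<close>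
  misses, modulo 1, the open arc with centre \<open>u\<close> and radius \<open>h\<close>.\<close>

definition avoiding :: "(nat \<Rightarrow> real) \<Rightarrow> real \<Rightarrow> real \<Rightarrow> real set" where
  "avoiding r u h = {t. \<forall>k\<ge>1. \<forall>n::int. h \<le> \<bar>r k * t - n - u\<bar>}"

text \<open>Within time \<open>1 / \<bar>d\<bar>\<close> the quantity \<open>t * d\<close> advances
  by a full unit, so \<open>t * d - y\<close> comes to an integer; it then stays within
  \<open>e\<close> of it for a time \<open>2 * e / \<bar>d\<bar>\<close>.\<close>

lemma window:
  fixes d y T e :: real
  assumes "e > 0" "d \<noteq> 0"
  shows "\<exists>a\<ge>T. a + 2 * e / \<bar>d\<bar> \<le> T + (1 + 2 * e) / \<bar>d\<bar> \<and>
           (\<forall>t\<in>{a..a + 2 * e / \<bar>d\<bar>}. \<exists>p::int. \<bar>t * d - y - p\<bar> \<le> e)"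
proof -
  have pos: "\<exists>a\<ge>T. a + 2 * e / d \<le> T + (1 + 2 * e) / d \<and>
           (\<forall>t\<in>{a..a + 2 * e / d}. \<exists>p::int. \<bar>t * d - y - p\<bar> \<le> e)" if "d > 0" for d y
  proof -
    \<comment> \<open>The first integer whose window starts no earlier than
      \<open>T\<close>.\<close>
    define p where "p = \<lceil>T * d + e - y\<rceil>"
    define a where "a = (y + p - e) / d"
    have p: "T * d + e - y \<le> p" "p \<le> T * d + e - y + 1"
      unfolding p_def by linarith+
    have "\<bar>t * d - y - p\<bar> \<le> e" if "t \<in> {a..a + 2 * e / d}" for t
    proof -
      have "a \<le> t" "t \<le> a + 2 * e / d" using that by auto
      then have "a * d \<le> t * d" "t * d \<le> (a + 2 * e / d) * d"
        using \<open>d > 0\<close> by (auto intro: mult_right_mono)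
      then have "y + p - e \<le> t * d" "t * d \<le> y + p + e"
        using \<open>d > 0\<close> by (auto simp: a_def distrib_right)
      then show ?thesis by linarith
    qed
    moreover have "T \<le> a"
      using p \<open>d > 0\<close> by (simp add: a_def field_simps)
    moreover have "a + 2 * e / d \<le> T + (1 + 2 * e) / d"
    proof -
      have "a + 2 * e / d = (y + p + e) / d"
        by (simp add: a_def add_divide_distrib diff_divide_distrib)
      also have "\<dots> \<le> (T * d + 1 + 2 * e) / d"
        using p \<open>d > 0\<close> by (intro divide_right_mono) auto
      also have "\<dots> = T + (1 + 2 * e) / d"
        using \<open>d > 0\<close> by (simp add: add_divide_distrib)
      finally show ?thesis .
    qed
    ultimately show ?thesis by blast
  qed
  show ?thesis
  proof (cases "d > 0")
    case True
    then show ?thesis using pos by simp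
  next
    case False
    \<comment> \<open>Negative speed is reduced to positive speed by changing the signs of
      \<open>d\<close>, \<open>y\<close> and the integer.\<close>
    then have "-d > 0" using assms by simp
    from pos[OF this, of "-y"] obtain a where a: "a \<ge> T" "a + 2 * e / (-d) \<le> T + (1 + 2 * e) / (-d)"
      and p: "\<forall>t\<in>{a..a + 2 * e / (-d)}. \<exists>p::int. \<bar>t * (-d) - (-y) - p\<bar> \<le> e" by blast
    have "\<exists>p::int. \<bar>t * d - y - p\<bar> \<le> e" if "t \<in> {a..a + 2 * e / (-d)}" for t
    proof -
      obtain p :: int where "\<bar>t * (-d) - (-y) - p\<bar> \<le> e" using p \<open>t \<in> _\<close> by blast
      then have "\<bar>t * d - y - of_int (-p)\<bar> \<le> e" by (simp add: abs_if split: if_splits)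
      then show ?thesis by blast
    qed
    moreover have "\<bar>d\<bar> = -d" using False by simp
    ultimately show ?thesis using a by metis
  qed
qed

text \<open>The windows are nested: by the ratio hypothesis, the time
  \<open>(1 + 2 * e) / \<bar>d (Suc i)\<bar>\<close> needed to find a window of the next speed fits
  into the window \<open>2 * e / \<bar>d i\<bar>\<close> of the present one.\<close>

lemma simultaneous_window:
  fixes d y :: "nat \<Rightarrow> real" and T e :: real
  assumes "e > 0" "\<And>i. i \<le> n \<Longrightarrow> d i \<noteq> 0"
    and "\<And>i. i < n \<Longrightarrow> \<bar>d i\<bar> * (1 + 2 * e) \<le> 2 * e * \<bar>d (Suc i)\<bar>"
  shows "\<exists>a\<ge>T. a + 2 * e / \<bar>d n\<bar> \<le> T + (1 + 2 * e) / \<bar>d 0\<bar> \<and>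
           (\<forall>t\<in>{a..a + 2 * e / \<bar>d n\<bar>}. \<forall>i\<le>n. \<exists>p::int. \<bar>t * d i - y i - p\<bar> \<le> e)"
  using assms
proof (induction n)
  case 0
  then show ?case using window[of e "d 0" T "y 0"] by auto
next
  case (Suc n)
  from Suc obtain a where a: "a \<ge> T" "a + 2 * e / \<bar>d n\<bar> \<le> T + (1 + 2 * e) / \<bar>d 0\<bar>"
    "\<forall>t\<in>{a..a + 2 * e / \<bar>d n\<bar>}. \<forall>i\<le>n. \<exists>p::int. \<bar>t * d i - y i - p\<bar> \<le> e"
    by fastforce
  obtain b where b: "b \<ge> a" "b + 2 * e / \<bar>d (Suc n)\<bar> \<le> a + (1 + 2 * e) / \<bar>d (Suc n)\<bar>"
    "\<forall>t\<in>{b..b + 2 * e / \<bar>d (Suc n)\<bar>}. \<exists>p::int. \<bar>t * d (Suc n) - y (Suc n) - p\<bar> \<le> e"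
    using window[of e "d (Suc n)" a "y (Suc n)"] Suc.prems by auto
  have "d n \<noteq> 0" "d (Suc n) \<noteq> 0" using Suc.prems by auto
  then have "(1 + 2 * e) / \<bar>d (Suc n)\<bar> \<le> 2 * e / \<bar>d n\<bar>"
    using Suc.prems(3)[of n] by (simp add: field_simps)
  then have sub: "b + 2 * e / \<bar>d (Suc n)\<bar> \<le> a + 2 * e / \<bar>d n\<bar>"
    using b(2) by linarith
  show ?case
  proof (intro exI[of _ b] conjI ballI allI impI)
    fix t i assume t: "t \<in> {b..b + 2 * e / \<bar>d (Suc n)\<bar>}" and "i \<le> Suc n"
    then have "t \<in> {a..a + 2 * e / \<bar>d n\<bar>}" using b(1) sub by auto
    then show "\<exists>p::int. \<bar>t * d i - y i - p\<bar> \<le> e"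
      using a(3) b(3) t \<open>i \<le> Suc n\<close> by (auto simp: le_Suc_eq)
  qed (use a b sub in auto)
qed

text \<open>If \<open>m\<close> points of the set lie at rapidly increasing distances \<open>\<bar>d i\<bar>\<close> from \<open>t\<close>, then there
  are times at which the points \<open>s * (t + d i)\<close> are nearly equidistributed modulo 1, whatever
  \<open>s * t\<close> is; at such a time \<open>s\<close> one of them hits the forbidden arc, so \<open>s\<close> is not a value of
  \<open>r\<close>.\<close>

lemma avoiding_gap:
  fixes r d :: "nat \<Rightarrow> real" and m :: nat
  assumes "m \<ge> 1" and mem: "\<And>i. i < m \<Longrightarrow> t + d i \<in> avoiding r u (1 / m)"
    and nz: "\<And>i. i < m \<Longrightarrow> d i \<noteq> 0"
    and ratio: "\<And>i. Suc i < m \<Longrightarrow> \<bar>d i\<bar> * (2 * real m + 1) \<le> \<bar>d (Suc i)\<bar>"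
  shows "\<exists>a\<ge>T. a + 1 / (2 * real m * \<bar>d (m - 1)\<bar>) \<le> T + 2 / \<bar>d 0\<bar> \<and>
           (\<forall>k\<ge>1. r k \<notin> {a..a + 1 / (2 * real m * \<bar>d (m - 1)\<bar>)})"
proof -
  \<comment> \<open>For this \<open>e\<close> the ratio \<open>(1 + 2 * e) / (2 * e)\<close>
    required for nested windows is exactly \<open>2 * m + 1\<close>.\<close>
  define e where "e = 1 / (4 * real m)"
  have m: "real m \<ge> 1" using \<open>m \<ge> 1\<close> by simp
  then have e: "e > 0" "2 * e = 1 / (2 * real m)" "e * m = 1 / 4" by (auto simp: e_def)
  have "\<bar>d i\<bar> * (1 + 2 * e) \<le> 2 * e * \<bar>d (Suc i)\<bar>" if "i < m - 1" for i
  proof -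
    have "\<bar>d i\<bar> * (1 + 2 * e) = 2 * e * (\<bar>d i\<bar> * (2 * real m + 1))"
      using m by (simp add: e_def field_simps)
    also have "\<dots> \<le> 2 * e * \<bar>d (Suc i)\<bar>"
      using ratio[of i] that e by (intro mult_left_mono) auto
    finally show ?thesis .
  qed
  \<comment> \<open>The phases \<open>i / m\<close> spread the \<open>m\<close> points evenly around
    the circle.\<close>
  then obtain a where a: "a \<ge> T" "a + 2 * e / \<bar>d (m - 1)\<bar> \<le> T + (1 + 2 * e) / \<bar>d 0\<bar>"
    "\<forall>s\<in>{a..a + 2 * e / \<bar>d (m - 1)\<bar>}. \<forall>i\<le>m - 1. \<exists>p::int. \<bar>s * d i - real i / m - p\<bar> \<le> e"
    using simultaneous_window[of e "m - 1" d T "\<lambda>i. real i / m"] nz e \<open>m \<ge> 1\<close> by auto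
  have len: "2 * e / \<bar>d (m - 1)\<bar> = 1 / (2 * real m * \<bar>d (m - 1)\<bar>)"
    by (simp add: e_def)
  have "r k \<notin> {a..a + 2 * e / \<bar>d (m - 1)\<bar>}" if "k \<ge> 1" for k
  proof
    assume k: "r k \<in> {a..a + 2 * e / \<bar>d (m - 1)\<bar>}"
    define x where "x = r k * t"
    \<comment> \<open>\<open>w\<close> is \<open>m * (u - x)\<close> rounded to a nearest integer
      and \<open>i\<close> its residue modulo \<open>m\<close>. So \<open>x + i / m\<close> is
      within \<open>2 * e\<close> of \<open>u\<close> modulo 1, and the window error raises this to
      \<open>3 * e\<close>, still below \<open>1 / m\<close>.\<close>
    define w where "w = \<lfloor>m * (u - x) + 1 / 2\<rfloor>"
    define i where "i = nat (w mod int m)"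
    have i: "i < m" using \<open>m \<ge> 1\<close> by (simp add: i_def nat_less_iff)
    have "w = int m * (w div int m) + int i"
      using \<open>m \<ge> 1\<close> by (simp add: i_def)
    then have w: "real_of_int w = m * real_of_int (w div int m) + i"
      by (metis of_int_add of_int_mult of_int_of_nat_eq)
    obtain p :: int where p: "\<bar>r k * d i - real i / m - p\<bar> \<le> e"
      using a(3) k i by (metis Suc_pred' le_simps(2) less_le_trans zero_less_one \<open>m \<ge> 1\<close>)
    have "\<bar>w - m * (u - x)\<bar> \<le> 1 / 2"
      unfolding w_def by linarith
    moreover define z where "z = real_of_int (w div int m) + i / m - (u - x)"
    have "w - m * (u - x) = m * z"
      using m by (simp add: z_def w right_diff_distrib distrib_left)
    ultimately have "m * \<bar>z\<bar> \<le> 1 / 2"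
      by (simp add: abs_mult)
    then have "\<bar>z\<bar> \<le> 2 * e"
      using m by (simp add: e_def field_simps)
    then have "\<bar>r k * (t + d i) - of_int (p - w div int m) - u\<bar> \<le> 3 * e"
      using p by (simp add: x_def z_def distrib_left)
    moreover have "3 * e < 1 / m"
      using m by (simp add: e_def field_simps)
    moreover have "1 / m \<le> \<bar>r k * (t + d i) - of_int (p - w div int m) - u\<bar>"
      using mem[OF i] that unfolding avoiding_def by blast
    ultimately show False by linarith
  qed
  moreover have "(1 + 2 * e) / \<bar>d 0\<bar> \<le> 2 / \<bar>d 0\<bar>"
    using m e by (intro divide_right_mono) auto
  ultimately show ?thesis
    using a(1,2) unfolding len by (intro exI[of _ a]) auto
qed

text \<open>The first term at or above \<open>a\<close> from \<open>k0\<close> on is preceded by a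
  term below \<open>a\<close>, so it overshoots \<open>a\<close> by at most
  \<open>l\<close>.\<close>

lemma rising_hits_interval:
  assumes "rising_to_infinity r" "k0 \<ge> 1" "r k0 < a"
    and gap: "\<And>k. k \<ge> k0 \<Longrightarrow> r k < a \<Longrightarrow> r (k + 1) - r k \<le> l"
  shows "\<exists>k\<ge>1. r k \<in> {a..a + l}"
proof -
  have "eventually (\<lambda>k. r k \<ge> a) sequentially"
    using assms(1) by (auto simp: rising_to_infinity_def filterlim_at_top)
  then obtain K where "\<forall>k\<ge>K. r k \<ge> a"
    by (auto simp: eventually_sequentially)
  then have "r (max K k0) \<ge> a" by simp
  then have ex: "\<exists>k. k \<ge> k0 \<and> r k \<ge> a" by (meson max.cobounded2)
  define k where "k = (LEAST k. k \<ge> k0 \<and> r k \<ge> a)"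
  have k: "k \<ge> k0" "r k \<ge> a"
    using LeastI_ex[OF ex] by (auto simp: k_def)
  then have "k > k0" using assms(3) by (cases "k = k0") auto
  then have "k - 1 \<ge> k0" "k - 1 < k" by auto
  then have "r (k - 1) < a"
    using not_less_Least[of "k - 1" "\<lambda>k. k \<ge> k0 \<and> r k \<ge> a"] by (auto simp: k_def)
  then have "r (k - 1 + 1) \<le> a + l"
    using gap[of "k - 1"] \<open>k - 1 \<ge> k0\<close> by linarith
  then show ?thesis
    using k \<open>k > k0\<close> assms(2) by (intro exI[of _ k]) auto
qed

text \<open>Near a limit point there are \<open>m\<close> rapidly shrinking offsets, all below
  \<open>1 / (2 * m * L)\<close>. The gap which they force has length at least \<open>L\<close> and
  lies beyond \<open>r k0\<close>, where \<open>r\<close> cannot jump over it.\<close>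

lemma avoiding_no_limit_point:
  assumes "rising_to_infinity r" "k0 \<ge> 1" "\<And>k. k \<ge> k0 \<Longrightarrow> r (k + 1) - r k \<le> L" "L > 0" "m \<ge> 1"
  shows "\<not> x islimpt avoiding r u (1 / real m)"
proof
  let ?X = "avoiding r u (1 / real m)"
  assume lim: "x islimpt ?X"
  have near: "\<exists>d. d \<noteq> 0 \<and> x + d \<in> ?X \<and> \<bar>d\<bar> < e" if "e > 0" for e
  proof -
    obtain y where "y \<in> ?X" "y \<noteq> x" "dist y x < e"
      using lim \<open>e > 0\<close> unfolding islimpt_approachable by blast
    then show ?thesis by (intro exI[of _ "y - x"]) (auto simp: dist_real_def)
  qed
  have m: "real m \<ge> 1" using \<open>m \<ge> 1\<close> by simp
  have "\<exists>f :: nat \<Rightarrow> real. \<forall>n. (f n \<noteq> 0 \<and> x + f n \<in> ?X \<and> \<bar>f n\<bar> < 1 / (2 * real m * L)) \<and> \<bar>f (Suc n)\<bar> * (2 * real m + 1) \<le> \<bar>f n\<bar>"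
  proof (rule dependent_nat_choice[where P = "\<lambda>_ d. d \<noteq> 0 \<and> x + d \<in> ?X \<and> \<bar>d\<bar> < 1 / (2 * real m * L)"
        and Q = "\<lambda>_ d d'. \<bar>d'\<bar> * (2 * real m + 1) \<le> \<bar>d\<bar>"])
    show "\<exists>d. d \<noteq> 0 \<and> x + d \<in> ?X \<and> \<bar>d\<bar> < 1 / (2 * real m * L)"
      using m \<open>L > 0\<close> by (intro near) auto
    fix d and n :: nat assume d: "d \<noteq> 0 \<and> x + d \<in> ?X \<and> \<bar>d\<bar> < 1 / (2 * real m * L)"
    then have pos: "\<bar>d\<bar> / (2 * real m + 1) > 0" using m by simp
    obtain d' where d': "d' \<noteq> 0" "x + d' \<in> ?X" "\<bar>d'\<bar> < \<bar>d\<bar> / (2 * real m + 1)"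
      using near[OF pos] by blast
    have "\<bar>d'\<bar> * (2 * real m + 1) \<le> \<bar>d\<bar>"
      using d'(3) m by (simp add: field_simps)
    moreover have "\<bar>d'\<bar> \<le> \<bar>d'\<bar> * (2 * real m + 1)"
      using m by (simp add: mult_le_cancel_left1)
    moreover from calculation have "\<bar>d'\<bar> < 1 / (2 * real m * L)"
      using d by linarith
    ultimately show "\<exists>d'. (d' \<noteq> 0 \<and> x + d' \<in> ?X \<and> \<bar>d'\<bar> < 1 / (2 * real m * L)) \<and> \<bar>d'\<bar> * (2 * real m + 1) \<le> \<bar>d\<bar>"
      using d d' by (intro exI[of _ d']) auto
  qed
  then obtain f where f: "\<And>n. f n \<noteq> 0" "\<And>n. x + f n \<in> ?X" "\<And>n. \<bar>f n\<bar> < 1 / (2 * real m * L)"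
    "\<And>n. \<bar>f (Suc n)\<bar> * (2 * real m + 1) \<le> \<bar>f n\<bar>"
    by blast
  \<comment> \<open>The offsets \<open>f\<close> shrink whereas \<open>avoiding_gap\<close> expects
    growing ones, so the order is reversed and \<open>f 0\<close> becomes the last offset.\<close>
  have "\<bar>f (m - 1 - i)\<bar> * (2 * real m + 1) \<le> \<bar>f (m - 1 - Suc i)\<bar>" if "Suc i < m" for i
    using f(4)[of "m - 1 - Suc i"] that by (simp add: Suc_diff_Suc)
  then obtain a where a: "a \<ge> r k0 + 1" "\<forall>k\<ge>1. r k \<notin> {a..a + 1 / (2 * real m * \<bar>f (m - 1 - (m - 1))\<bar>)}"
    using avoiding_gap[of m x "\<lambda>i. f (m - 1 - i)" r u "r k0 + 1"] f \<open>m \<ge> 1\<close> by auto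
  have "L \<le> 1 / (2 * real m * \<bar>f 0\<bar>)"
    using f(3)[of 0] f(1)[of 0] m \<open>L > 0\<close> by (simp add: field_simps)
  then have "\<exists>k\<ge>1. r k \<in> {a..a + 1 / (2 * real m * \<bar>f 0\<bar>)}"
    using assms(3) a(1) by (intro rising_hits_interval[OF assms(1,2)]) force+
  then show False using a(2) by auto
qed

section \<open>Sublacunary sequences\<close>

text \<open>Cut the hull of \<open>S\<close>, of length \<open>D\<close>, into cells of length
  \<open>D / N\<close>. By pigeonhole one cell holds enough points for the induction; its chain is
  extended at the front by an extreme point of \<open>S\<close>.\<close>

lemma exists_rapid_chain:
  fixes S :: "real set" and N :: nat
  assumes "finite S" "card S > (N + 1) ^ b" "N \<ge> 1"
  shows "\<exists>x\<in>S. \<exists>f :: nat \<Rightarrow> real. (\<forall>i\<le>b. x + f i \<in> S \<and> f i \<noteq> 0) \<and> (\<forall>i<b. N * \<bar>f (Suc i)\<bar> \<le> 2 * \<bar>f i\<bar>)"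
  using assms(1,2)
proof (induction b arbitrary: S)
  case 0
  then have "\<not> card S \<le> Suc 0" by simp
  then obtain x y where "x \<in> S" "y \<in> S" "x \<noteq> y"
    using card_le_Suc0_iff_eq[OF \<open>finite S\<close>] by blast
  then show ?case
    by (intro bexI[of _ x] exI[of _ "\<lambda>_. y - x"]) auto
next
  case (Suc b)
  define lo hi where "lo = Min S" and "hi = Max S"
  define D where "D = hi - lo"
  have "(N + 1) ^ Suc b \<ge> 1" by (rule one_le_power) simp
  then have card: "card S > 1" using Suc.prems by linarith
  then have "S \<noteq> {}" by auto
  then have S: "lo \<in> S" "hi \<in> S" "\<And>x. x \<in> S \<Longrightarrow> lo \<le> x \<and> x \<le> hi"
    using \<open>finite S\<close> by (auto simp: lo_def hi_def)
  have "D > 0"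
  proof (rule ccontr)
    assume "\<not> D > 0"
    then have "S \<subseteq> {lo}" using S(3) by (force simp: D_def)
    then have "card S \<le> 1" using card_mono[of "{lo}" S] by simp
    then show False using card by simp
  qed
  \<comment> \<open>The maximum \<open>hi\<close> has the cell number \<open>N\<close>, which
    accounts for \<open>N + 1\<close> cells.\<close>
  define g where "g x = \<lfloor>(x - lo) * N / D\<rfloor>" for x
  have "g \<in> S \<rightarrow> {0..int N}"
  proof
    fix x assume "x \<in> S"
    then have "0 \<le> x - lo" "x - lo \<le> D" using S(3) by (auto simp: D_def)
    moreover from this have "(x - lo) * N \<le> D * N" by (intro mult_right_mono) auto
    ultimately have "0 \<le> (x - lo) * N / D" "(x - lo) * N / D \<le> N"
      using \<open>D > 0\<close> by (auto simp: pos_divide_le_eq mult.commute)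
    then show "g x \<in> {0..int N}" unfolding g_def by (auto simp: floor_le_iff)
  qed
  then obtain v where v: "card (g -` {v} \<inter> S) * card {0..int N} \<ge> card S"
    using pigeonhole_card[of g S "{0..int N}"] \<open>finite S\<close> by auto
  define S' where "S' = g -` {v} \<inter> S"
  have "card S' * (N + 1) > (N + 1) ^ b * (N + 1)"
    using v Suc.prems by (simp add: S'_def algebra_simps nat_add_distrib)
  then have "card S' > (N + 1) ^ b" by (simp only: mult_less_cancel2)
  with Suc.IH[of S'] obtain x and f :: "nat \<Rightarrow> real" where x: "x \<in> S'"
    and f: "\<forall>i\<le>b. x + f i \<in> S' \<and> f i \<noteq> 0" "\<forall>i<b. N * \<bar>f (Suc i)\<bar> \<le> 2 * \<bar>f i\<bar>"
    using \<open>finite S\<close> by (auto simp: S'_def)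
  \<comment> \<open>The offset to an extreme point at distance at least \<open>D / 2\<close> from
    \<open>x\<close>; the next offset \<open>f 0\<close> stays in one cell and so is at most
    \<open>D / N\<close>.\<close>
  define d where "d = (if x - lo \<ge> D / 2 then lo - x else hi - x)"
  have d: "\<bar>d\<bar> \<ge> D / 2" "x + d \<in> S"
    using S(1,2) unfolding d_def D_def by (auto simp: abs_if)
  have "g x = g (x + f 0)"
    using x f(1) by (auto simp: S'_def)
  then have "\<bar>(x + f 0 - lo) * N / D - (x - lo) * N / D\<bar> \<le> 1"
    unfolding g_def by linarith
  moreover have "(x + f 0 - lo) * N / D - (x - lo) * N / D = N * f 0 / D"
    by (simp add: diff_divide_distrib[symmetric] algebra_simps)
  ultimately have "N * \<bar>f 0\<bar> \<le> D"
    using \<open>D > 0\<close> by (simp add: abs_mult field_simps)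
  then have *: "N * \<bar>f 0\<bar> \<le> 2 * \<bar>d\<bar>" using d by linarith
  show ?case
  proof (intro bexI[of _ x] exI[of _ "case_nat d f"] conjI allI impI)
    fix i assume "i \<le> Suc b"
    then show "x + case_nat d f i \<in> S" "case_nat d f i \<noteq> 0"
      using d f(1) \<open>D > 0\<close> by (auto simp: S'_def split: nat.split)
  next
    fix i assume "i < Suc b"
    then show "N * \<bar>case_nat d f (Suc i)\<bar> \<le> 2 * \<bar>case_nat d f i\<bar>"
      using * f(2) by (cases i) auto
  qed (use x in \<open>auto simp: S'_def\<close>)
qed

text \<open>If the largest offset were at most \<open>R * \<bar>d 0\<bar>\<close>, then
  \<open>avoiding_gap\<close> would give a gap near \<open>1 / \<bar>d 0\<bar>\<close> whose
  relative size is bounded below in terms of \<open>m\<close> and \<open>R\<close>. Sublacunarity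
  rules this out once \<open>\<bar>d 0\<bar>\<close> is small.\<close>

lemma avoiding_spread:
  assumes "rising_to_infinity r" "sublacunary r" "m \<ge> 1" "R > 0"
  shows "\<exists>l>0. \<forall>t d. (\<forall>i<m. t + d i \<in> avoiding r u (1 / real m) \<and> d i \<noteq> 0) \<longrightarrow>
      (\<forall>i. Suc i < m \<longrightarrow> \<bar>d i\<bar> * (2 * real m + 1) \<le> \<bar>d (Suc i)\<bar>) \<longrightarrow> \<bar>d 0\<bar> < l \<longrightarrow>
      R * \<bar>d 0\<bar> < \<bar>d (m - 1)\<bar>"
proof -
  have m: "real m \<ge> 1" using \<open>m \<ge> 1\<close> by simp
  \<comment> \<open>The gap lies below \<open>3 / \<bar>d 0\<bar>\<close>, and \<open>\<kappa> * (3
    / \<bar>d 0\<bar>) = 1 / (2 * m * R * \<bar>d 0\<bar>)\<close> is then at most its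
    length.\<close>
  define \<kappa> where "\<kappa> = 1 / (6 * real m * R)"
  have "\<kappa> > 0" using m \<open>R > 0\<close> by (simp add: \<kappa>_def)
  have "eventually (\<lambda>k. r (k + 1) / r k < 1 + \<kappa>) sequentially"
    using assms(2) \<open>\<kappa> > 0\<close> unfolding sublacunary_def by (intro order_tendstoD(2)) auto
  moreover have "eventually (\<lambda>k. r k > 0) sequentially"
    using assms(1) by (auto simp: rising_to_infinity_def filterlim_at_top_dense)
  moreover have "eventually (\<lambda>k. k \<ge> 1) sequentially"
    by (rule eventually_ge_at_top)
  ultimately have "eventually (\<lambda>k. k \<ge> 1 \<and> r k > 0 \<and> r (k + 1) - r k \<le> \<kappa> * r k) sequentially"
    by eventually_elim (auto simp: field_simps)
  then obtain k0 where k0: "\<And>k. k \<ge> k0 \<Longrightarrow> k \<ge> 1 \<and> r k > 0 \<and> r (k + 1) - r k \<le> \<kappa> * r k"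
    unfolding eventually_sequentially by blast
  show ?thesis
  \<comment> \<open>This bound on \<open>\<bar>d 0\<bar>\<close> places the gap beyond
    \<open>r k0\<close>, where the relative gaps of \<open>r\<close> are controlled.\<close>
  proof (intro exI[of _ "1 / (r k0 + 1)"] conjI allI impI)
    show "1 / (r k0 + 1) > 0" using k0[of k0] by simp
    fix t and d :: "nat \<Rightarrow> real"
    assume "\<forall>i<m. t + d i \<in> avoiding r u (1 / real m) \<and> d i \<noteq> 0"
      and "\<forall>i. Suc i < m \<longrightarrow> \<bar>d i\<bar> * (2 * real m + 1) \<le> \<bar>d (Suc i)\<bar>"
    then have mem: "\<And>i. i < m \<Longrightarrow> t + d i \<in> avoiding r u (1 / real m)"
      and nz: "\<And>i. i < m \<Longrightarrow> d i \<noteq> 0"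
      and ratio: "\<And>i. Suc i < m \<Longrightarrow> \<bar>d i\<bar> * (2 * real m + 1) \<le> \<bar>d (Suc i)\<bar>"
      by auto
    assume small: "\<bar>d 0\<bar> < 1 / (r k0 + 1)"
    have d0: "\<bar>d 0\<bar> > 0" using nz[of 0] \<open>m \<ge> 1\<close> by simp
    have dm: "\<bar>d (m - 1)\<bar> > 0" using nz[of "m - 1"] \<open>m \<ge> 1\<close> by simp
    define l where "l = 1 / (2 * real m * \<bar>d (m - 1)\<bar>)"
    obtain a where a: "a \<ge> 1 / \<bar>d 0\<bar>" "a + l \<le> 1 / \<bar>d 0\<bar> + 2 / \<bar>d 0\<bar>"
      "\<forall>k\<ge>1. r k \<notin> {a..a + l}"
      using avoiding_gap[OF \<open>m \<ge> 1\<close>, of t d r u "1 / \<bar>d 0\<bar>"] mem nz ratio unfolding l_def by blast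
    have "l > 0" using m dm by (simp add: l_def)
    show "R * \<bar>d 0\<bar> < \<bar>d (m - 1)\<bar>"
    proof (rule ccontr)
      assume "\<not> ?thesis"
      then have le: "\<bar>d (m - 1)\<bar> \<le> R * \<bar>d 0\<bar>" by simp
      have "\<kappa> * (3 / \<bar>d 0\<bar>) = 1 / (2 * real m * (R * \<bar>d 0\<bar>))"
        by (simp add: \<kappa>_def)
      also have "\<dots> \<le> l"
        unfolding l_def using le dm m d0 \<open>R > 0\<close> by (intro divide_left_mono mult_left_mono mult_pos_pos) auto
      finally have l: "\<kappa> * (3 / \<bar>d 0\<bar>) \<le> l" .
      have "r k0 + 1 < 1 / \<bar>d 0\<bar>"
        using small d0 k0[of k0] by (simp add: field_simps)
      moreover have "r (k + 1) - r k \<le> l" if "k \<ge> k0" "r k < a" for k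
      proof -
        have "r k \<le> 3 / \<bar>d 0\<bar>" using that(2) a(2) \<open>l > 0\<close> by simp
        then have "\<kappa> * r k \<le> \<kappa> * (3 / \<bar>d 0\<bar>)"
          using \<open>\<kappa> > 0\<close> by (intro mult_left_mono) auto
        then show ?thesis using k0[OF that(1)] l by linarith
      qed
      ultimately have "\<exists>k\<ge>1. r k \<in> {a..a + l}"
        using rising_hits_interval[OF assms(1), of k0 a l] k0[of k0] a(1) by auto
      then show False using a(3) by blast
    qed
  qed
qed

text \<open>A larger set would contain a rapid chain of \<open>m * g + 1\<close> offsets. By
  \<open>avoiding_spread\<close>, every \<open>m\<close> consecutive ones cost a factor
  \<open>R\<close>, so the last would be smaller than \<open>l / R ^ g\<close>, against the
  separation. The base \<open>(4 * m + 3) ^ m\<close> is independent of \<open>R\<close>.\<close>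

lemma avoiding_card_separated:
  assumes "rising_to_infinity r" "sublacunary r" "m \<ge> 1" "R \<ge> 1"
  shows "\<exists>l>0. \<forall>g S. finite S \<longrightarrow> S \<subseteq> avoiding r u (1 / real m) \<longrightarrow>
      (\<forall>x\<in>S. \<forall>y\<in>S. dist x y < l \<and> (x \<noteq> y \<longrightarrow> l / R ^ g \<le> dist x y)) \<longrightarrow>
      card S \<le> ((4 * m + 3) ^ m) ^ g"
proof -
  have "R > 0" using assms by simp
  obtain l where l: "l > 0" and spread:
    "\<And>t d. (\<forall>i<m. t + d i \<in> avoiding r u (1 / real m) \<and> d i \<noteq> 0) \<Longrightarrow>
      (\<forall>i. Suc i < m \<longrightarrow> \<bar>d i\<bar> * (2 * real m + 1) \<le> \<bar>d (Suc i)\<bar>) \<Longrightarrow> \<bar>d 0\<bar> < l \<Longrightarrow>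
      R * \<bar>d 0\<bar> < \<bar>d (m - 1)\<bar>"
    using avoiding_spread[OF assms(1-3) \<open>R > 0\<close>] by meson
  show ?thesis
  proof (intro exI[of _ l] conjI allI impI)
    fix g and S :: "real set"
    assume S: "finite S" "S \<subseteq> avoiding r u (1 / real m)" and
      "\<forall>x\<in>S. \<forall>y\<in>S. dist x y < l \<and> (x \<noteq> y \<longrightarrow> l / R ^ g \<le> dist x y)"
    then have S': "\<And>x y. x \<in> S \<Longrightarrow> y \<in> S \<Longrightarrow> dist x y < l"
      "\<And>x y. x \<in> S \<Longrightarrow> y \<in> S \<Longrightarrow> x \<noteq> y \<Longrightarrow> l / R ^ g \<le> dist x y"
      by auto
    show "card S \<le> ((4 * m + 3) ^ m) ^ g"
    proof (rule ccontr)
      assume "\<not> ?thesis"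
      \<comment> \<open>With \<open>N = 4 * m + 2\<close> the chain shrinks by
        \<open>N / 2 = 2 * m + 1\<close> per step, as \<open>avoiding_spread\<close>
        demands.\<close>
      moreover have "4 * m + 2 + 1 = 4 * m + 3" by simp
      ultimately have "card S > (4 * m + 2 + 1) ^ (m * g)"
        by (simp only: power_mult not_le)
      then obtain x f where x: "x \<in> S" and f: "\<And>i. i \<le> m * g \<Longrightarrow> x + f i \<in> S \<and> f i \<noteq> 0"
        and chain: "\<And>i. i < m * g \<Longrightarrow> real (4 * m + 2) * \<bar>f (Suc i)\<bar> \<le> 2 * \<bar>f i\<bar>"
        using exists_rapid_chain[OF S(1), of "4 * m + 2" "m * g"] by auto
      have chain': "\<bar>f (Suc i)\<bar> * (2 * real m + 1) \<le> \<bar>f i\<bar>" if "i < m * g" for i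
        using chain[OF that] by (simp add: algebra_simps)
      have small: "\<bar>f i\<bar> < l" if "i \<le> m * g" for i
        using S'(1)[OF x, of "x + f i"] f[OF that] by (simp add: dist_real_def)
      have step: "R * \<bar>f (m * Suc w)\<bar> \<le> \<bar>f (m * w)\<bar>" if "w < g" for w
      proof -
        have wg: "m * Suc w \<le> m * g" using that by (intro mult_le_mono) auto
        then have "m * w + m \<le> m * g" by simp
        then have lt: "m * w + i < m * g" if "i < m" for i using that by linarith
        \<comment> \<open>The \<open>w\<close>-th block of \<open>m\<close> offsets, in increasing
          order of size.\<close>
        define d where "d i = f (m * w + (m - 1 - i))" for i
        have "R * \<bar>d 0\<bar> < \<bar>d (m - 1)\<bar>"
        proof (rule spread[of x d]; (intro allI impI)?)
          fix i assume "i < m"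
          then have "m * w + (m - 1 - i) \<le> m * g" using lt[of "m - 1 - i"] by simp
          then show "x + d i \<in> avoiding r u (1 / real m) \<and> d i \<noteq> 0"
            using f S(2) by (auto simp: d_def)
        next
          fix i assume i: "Suc i < m"
          then have "Suc (m * w + (m - 1 - Suc i)) = m * w + (m - 1 - i)" by simp
          moreover have "m * w + (m - 1 - Suc i) < m * g" using lt[of "m - 1 - Suc i"] i by simp
          ultimately show "\<bar>d i\<bar> * (2 * real m + 1) \<le> \<bar>d (Suc i)\<bar>"
            unfolding d_def using chain' by metis
        next
          show "\<bar>d 0\<bar> < l"
            using small[of "m * w + (m - 1)"] lt[of "m - 1"] \<open>m \<ge> 1\<close> by (simp add: d_def)
        qed
        then have "R * \<bar>f (m * w + (m - 1))\<bar> < \<bar>f (m * w)\<bar>" by (simp add: d_def)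
        moreover have "\<bar>f (m * Suc w)\<bar> \<le> \<bar>f (m * w + (m - 1))\<bar>"
        proof -
          have lt': "m * w + (m - 1) < m * g" using lt[of "m - 1"] \<open>m \<ge> 1\<close> by simp
          have "m * Suc w = Suc (m * w + (m - 1))" using \<open>m \<ge> 1\<close> by simp
          then have "\<bar>f (m * Suc w)\<bar> * (2 * real m + 1) \<le> \<bar>f (m * w + (m - 1))\<bar>"
            using chain'[OF lt'] by (simp only:)
          moreover have "\<bar>f (m * Suc w)\<bar> \<le> \<bar>f (m * Suc w)\<bar> * (2 * real m + 1)"
            by (simp add: mult_le_cancel_left1)
          ultimately show ?thesis by linarith
        qed
        then have "R * \<bar>f (m * Suc w)\<bar> \<le> R * \<bar>f (m * w + (m - 1))\<bar>"
          using \<open>R > 0\<close> by (intro mult_left_mono) auto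
        ultimately show ?thesis by linarith
      qed
      have "R ^ w * \<bar>f (m * w)\<bar> \<le> \<bar>f 0\<bar>" if "w \<le> g" for w
        using that
      proof (induction w)
        case (Suc w)
        have "R ^ Suc w * \<bar>f (m * Suc w)\<bar> = R ^ w * (R * \<bar>f (m * Suc w)\<bar>)" by simp
        also have "\<dots> \<le> R ^ w * \<bar>f (m * w)\<bar>"
          using step[of w] Suc.prems \<open>R > 0\<close> by (intro mult_left_mono) auto
        also have "\<dots> \<le> \<bar>f 0\<bar>" using Suc by simp
        finally show ?case .
      qed simp
      from this[of g] have "R ^ g * \<bar>f (m * g)\<bar> < l"
        using small[of 0] by simp
      moreover have "l / R ^ g \<le> \<bar>f (m * g)\<bar>"
        using S'(2)[OF x, of "x + f (m * g)"] f[of "m * g"] by (simp add: dist_real_def)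
      ultimately show False
        using \<open>R > 0\<close> by (simp add: field_simps)
    qed
  qed (rule l)
qed

text \<open>A maximal \<open>\<rho>\<close>-separated subset is a \<open>\<rho>\<close>-net.\<close>

lemma hausdorff_null_card_separated:
  fixes A :: "'a::metric_space set" and P :: nat
  assumes "s > 0" "R > 1" "real P < R powr s" "l > 0"
    and card: "\<And>g S. \<lbrakk>finite S; S \<subseteq> A; \<And>x y. x \<in> S \<Longrightarrow> y \<in> S \<Longrightarrow> x \<noteq> y \<Longrightarrow> l / R ^ g \<le> dist x y\<rbrakk>
      \<Longrightarrow> card S \<le> P ^ g"
  shows "hausdorff_measure s A = 0"
proof (rule hausdorff_null_finite_coverI)
  fix e :: real assume "e > 0"
  have Rs: "R powr s > 0" using \<open>R > 1\<close> by simp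
  \<comment> \<open>This is the cost of \<open>P ^ g\<close> balls of radius
    \<open>l / R ^ g\<close>.\<close>
  have "(\<lambda>g. (2 * l) powr s * (P / R powr s) ^ g) \<longlonglongrightarrow> (2 * l) powr s * 0"
    using assms(3) Rs by (intro tendsto_mult LIMSEQ_realpow_zero) auto
  then have "eventually (\<lambda>g. (2 * l) powr s * (P / R powr s) ^ g < e) sequentially"
    using \<open>e > 0\<close> by (intro order_tendstoD(2)) auto
  moreover have "(\<lambda>g. (2 * l) * (1 / R) ^ g) \<longlonglongrightarrow> (2 * l) * 0"
    using \<open>R > 1\<close> by (intro tendsto_mult LIMSEQ_realpow_zero) auto
  then have "eventually (\<lambda>g. (2 * l) * (1 / R) ^ g < e) sequentially"
    using \<open>e > 0\<close> by (intro order_tendstoD(2)) auto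
  ultimately have "eventually (\<lambda>g. (2 * l) powr s * (P / R powr s) ^ g < e \<and> (2 * l) * (1 / R) ^ g < e) sequentially"
    by (rule eventually_conj)
  then obtain g where g: "(2 * l) powr s * (P / R powr s) ^ g < e" "(2 * l) * (1 / R) ^ g < e"
    using eventually_happens'[OF sequentially_bot] by blast
  define \<rho> where "\<rho> = l / R ^ g"
  have "\<rho> > 0" using assms by (simp add: \<rho>_def)
  define Q where "Q S \<longleftrightarrow> finite S \<and> S \<subseteq> A \<and> (\<forall>x\<in>S. \<forall>y\<in>S. x \<noteq> y \<longrightarrow> \<rho> \<le> dist x y)" for S
  have Q: "card S \<le> P ^ g" if "Q S" for S
    using that card[of S g] by (auto simp: Q_def \<rho>_def)
  \<comment> \<open>The uniform bound \<open>P ^ g\<close> provides a separated set of largest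
    cardinality; an uncovered point could be added to it.\<close>
  have "\<exists>S. Q S \<and> (\<forall>T. Q T \<longrightarrow> card T \<le> card S)"
  proof (rule ex_has_greatest_nat[of Q "{}" card "Suc (P ^ g)"])
    show "Q {}" by (simp add: Q_def)
    show "\<forall>T. Q T \<longrightarrow> card T < Suc (P ^ g)" using Q by (simp add: less_Suc_eq_le)
  qed
  then obtain S where S: "Q S" "\<And>T. Q T \<Longrightarrow> card T \<le> card S" by blast
  have fin: "finite S" using S(1) by (simp add: Q_def)
  have cover: "A \<subseteq> (\<Union>x\<in>S. cball x \<rho>)"
  proof
    fix z assume "z \<in> A"
    show "z \<in> (\<Union>x\<in>S. cball x \<rho>)"
    proof (rule ccontr)
      assume z: "z \<notin> (\<Union>x\<in>S. cball x \<rho>)"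
      then have "z \<notin> S" using \<open>\<rho> > 0\<close> by auto
      have "Q (insert z S)"
        using S(1) \<open>z \<in> A\<close> z by (force simp: Q_def dist_commute)
      then have "card (insert z S) \<le> card S" by (rule S(2))
      then show False using \<open>z \<notin> S\<close> fin by simp
    qed
  qed
  obtain h where h: "bij_betw h {..<card S} S"
    using ex_bij_betw_nat_finite[OF fin] by (auto simp: atLeast0LessThan)
  have diam: "diameter (cball x \<rho>) \<le> 2 * \<rho>" for x :: 'a
  proof -
    have "dist a b \<le> 2 * \<rho>" if "a \<in> cball x \<rho>" "b \<in> cball x \<rho>" for a b
      using that dist_triangle3[of a b x] by simp
    then show ?thesis
      unfolding diameter_def using \<open>\<rho> > 0\<close> by (auto intro!: cSUP_least)
  qed
  have cost: "diam_cost s (cball x \<rho>) \<le> ennreal ((2 * \<rho>) powr s)" for x :: 'a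
    using diam[of x] \<open>s > 0\<close> diameter_ge_0[OF bounded_cball]
    by (auto simp: diam_cost_def intro!: ennreal_leI powr_mono2)
  show "\<exists>n (U :: nat \<Rightarrow> 'a set). A \<subseteq> (\<Union>i<n. U i) \<and>
      (\<forall>i<n. bounded (U i) \<and> diameter (U i) \<le> e) \<and> (\<Sum>i<n. diam_cost s (U i)) \<le> ennreal e"
  proof (intro exI[of _ "card S"] exI[of _ "\<lambda>i. cball (h i) \<rho>"] conjI allI impI)
    show "A \<subseteq> (\<Union>i<card S. cball (h i) \<rho>)"
    proof
      fix z assume "z \<in> A"
      then obtain x where x: "x \<in> S" "z \<in> cball x \<rho>" using cover by blast
      then obtain i where "i < card S" "x = h i" using bij_betw_imp_surj_on[OF h] by blast
      then show "z \<in> (\<Union>i<card S. cball (h i) \<rho>)" using x by blast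
    qed
    have "2 * \<rho> = 2 * l * (1 / R) ^ g"
      by (simp add: \<rho>_def power_one_over)
    then show "diameter (cball (h i) \<rho>) \<le> e" for i
      using diam[of "h i"] g(2) by linarith
    have "(\<Sum>i<card S. diam_cost s (cball (h i) \<rho>)) \<le> (\<Sum>i<card S. ennreal ((2 * \<rho>) powr s))"
      by (intro sum_mono cost)
    also have "\<dots> = ennreal (card S * (2 * \<rho>) powr s)"
      by (simp add: ennreal_mult ennreal_of_nat_eq_real_of_nat)
    also have "\<dots> \<le> ennreal e"
    proof (rule ennreal_leI)
      have "(2 * \<rho>) powr s = (2 * l) powr s / (R powr s) ^ g"
        using \<open>R > 1\<close> \<open>l > 0\<close> by (simp add: \<rho>_def powr_divide powr_powr mult.commute flip: powr_realpow)
      then have "(2 * l) powr s * (P / R powr s) ^ g = P ^ g * (2 * \<rho>) powr s"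
        by (simp add: power_divide)
      moreover have "card S * (2 * \<rho>) powr s \<le> real (P ^ g) * (2 * \<rho>) powr s"
        using Q[OF S(1)] by (intro mult_right_mono) (auto simp del: of_nat_power)
      ultimately show "card S * (2 * \<rho>) powr s \<le> e"
        using g(1) by simp
    qed
    finally show "(\<Sum>i<card S. diam_cost s (cball (h i) \<rho>)) \<le> ennreal e" .
  qed auto
qed

text \<open>Since \<open>P\<close> does not depend on \<open>R\<close>, the factor \<open>R\<close>
  can be chosen after it with \<open>R powr s > P\<close>, for any positive \<open>s\<close>. The
  local counting bound then applies to countably many short pieces.\<close>

lemma hausdorff_null_avoiding:
  assumes "rising_to_infinity r" "sublacunary r" "m \<ge> 1" "s > 0"
  shows "hausdorff_measure s (avoiding r u (1 / real m)) = 0"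
proof -
  let ?X = "avoiding r u (1 / real m)"
  define P where "P = (4 * m + 3) ^ m"
  define R where "R = (1 + real P) powr (1 / s)"
  have "P > 0" by (simp add: P_def)
  then have R: "R > 1" using \<open>s > 0\<close> by (simp add: R_def)
  have "real P < R powr s" using \<open>s > 0\<close> by (simp add: R_def powr_powr)
  obtain l where l: "l > 0" and card: "\<And>g S. finite S \<Longrightarrow> S \<subseteq> ?X \<Longrightarrow>
      (\<forall>x\<in>S. \<forall>y\<in>S. dist x y < l \<and> (x \<noteq> y \<longrightarrow> l / R ^ g \<le> dist x y)) \<Longrightarrow> card S \<le> P ^ g"
    using avoiding_card_separated[OF assms(1-3) less_imp_le[OF R], of u] unfolding P_def by meson
  \<comment> \<open>Cells of length \<open>l / 2\<close>, to keep distances within a cell strictly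
    below \<open>l\<close>.\<close>
  define J where "J j = {t. \<lfloor>t / (l / 2)\<rfloor> = j}" for j :: int
  have J: "dist x y < l" if "x \<in> J j" "y \<in> J j" for x y j
  proof -
    have "\<bar>x / (l / 2) - y / (l / 2)\<bar> \<le> 1" using that unfolding J_def by simp linarith
    then have "\<bar>(x - y) / (l / 2)\<bar> \<le> 1" by (simp only: diff_divide_distrib)
    then have "\<bar>x - y\<bar> \<le> l / 2" using l by (simp add: abs_if field_simps split: if_splits)
    then show ?thesis using l by (simp add: dist_real_def)
  qed
  have "hausdorff_measure s (?X \<inter> J j) = 0" for j
    using \<open>s > 0\<close> R \<open>real P < R powr s\<close> l
  proof (rule hausdorff_null_card_separated)
    fix g S assume "finite S" "S \<subseteq> ?X \<inter> J j" "\<And>x y. x \<in> S \<Longrightarrow> y \<in> S \<Longrightarrow> x \<noteq> y \<Longrightarrow> l / R ^ g \<le> dist x y"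
    then show "card S \<le> P ^ g" using J by (intro card ballI conjI impI) blast+
  qed
  then have "hausdorff_measure s (\<Union>j. ?X \<inter> J j) = 0"
    by (intro hausdorff_null_UN) auto
  moreover have "?X \<subseteq> (\<Union>j. ?X \<inter> J j)" by (auto simp: J_def)
  ultimately show ?thesis by (rule hausdorff_null_subset)
qed

section \<open>Reduction to avoiding sets\<close>

lemma countable_avoiding:
  assumes "rising_to_infinity r" "limsup (\<lambda>k. ereal (r (k + 1) - r k)) < \<infinity>" "m \<ge> 1"
  shows "countable (avoiding r u (1 / real m))"
proof -
  let ?X = "avoiding r u (1 / real m)"
  obtain n :: nat where "limsup (\<lambda>k. ereal (r (k + 1) - r k)) < ereal (real n)"
    using assms(2) less_PInf_Ex_of_nat by (metis less_irrefl)
  then have "eventually (\<lambda>k. ereal (r (k + 1) - r k) < ereal (real n)) sequentially"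
    by (rule Limsup_lessD)
  then obtain k0 where k0: "\<And>k. k \<ge> k0 \<Longrightarrow> r (k + 1) - r k < real n"
    unfolding eventually_sequentially by auto
  have "\<not> x islimpt ?X" for x
  proof (rule avoiding_no_limit_point[OF assms(1)])
    show "max k0 1 \<ge> 1" "real n + 1 > 0" by auto
    show "r (k + 1) - r k \<le> real n + 1" if "k \<ge> max k0 1" for k
      using k0[of k] that by simp
  qed fact
  then have "\<not> x islimpt (?X \<inter> {-real n..real n})" for x and n :: nat
    by (meson inf_le1 islimpt_subset)
  then have "finite (?X \<inter> {-real n..real n})" for n :: nat
    using Heine_Borel_imp_Bolzano_Weierstrass[OF compact_Icc _ inf_le2] by blast
  then have "countable (\<Union>n::nat. ?X \<inter> {-real n..real n})"
    by (intro countable_UN[OF _ countable_finite]) simp_all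
  moreover have "?X \<subseteq> (\<Union>n::nat. ?X \<inter> {-real n..real n})"
  proof
    fix x assume "x \<in> ?X"
    moreover obtain n :: nat where "\<bar>x\<bar> \<le> real n" using real_arch_simple by blast
    ultimately have "x \<in> ?X \<inter> {-real n..real n}" by auto
    then show "x \<in> (\<Union>n::nat. ?X \<inter> {-real n..real n})" by blast
  qed
  ultimately show ?thesis by (rule countable_subset[rotated])
qed

text \<open>A projection that is not dense misses an interval around some \<open>z\<close>. Division
  by \<open>cos \<alpha>\<close> turns this into a missed arc for \<open>r k * tan \<alpha>\<close>
  modulo 1. Rational centres and radii \<open>1 / m\<close> make the family countable; the angles
  with \<open>cos \<alpha> = 0\<close> are multiples of \<open>pi / 2\<close>.\<close>

lemma E_subset_avoiding:
  "E (M_of r) \<subseteq> range (\<lambda>i::int. i * (pi / 2)) \<union>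
     (\<Union>(j::int, u, m)\<in>UNIV \<times> \<rat> \<times> {1::nat..}. (\<lambda>t. arctan t + j * pi) ` avoiding r u (1 / real m))"
proof
  fix \<alpha> assume "\<alpha> \<in> E (M_of r)"
  then have dense: "closure (\<Phi> \<alpha> ` M_of r) \<noteq> UNIV"
    by (auto simp: E_def DEN_def dense_set_def)
  show "\<alpha> \<in> range (\<lambda>i::int. i * (pi / 2)) \<union>
     (\<Union>(j::int, u, m)\<in>UNIV \<times> \<rat> \<times> {1::nat..}. (\<lambda>t. arctan t + j * pi) ` avoiding r u (1 / real m))"
  proof (cases "cos \<alpha> = 0")
    case True
    then show ?thesis unfolding cos_zero_iff_int by blast
  next
    case False
    then obtain j where j: "arctan (tan \<alpha>) = \<alpha> - of_int j * pi"
      by (rule arctan_tan_eq_abs_pi)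
    obtain z where "z \<notin> closure (\<Phi> \<alpha> ` M_of r)" using dense by blast
    then obtain e where "e > 0" and z: "\<forall>y\<in>\<Phi> \<alpha> ` M_of r. \<not> dist y z < e"
      unfolding closure_approachable by blast
    define w where "w = z / cos \<alpha>"
    \<comment> \<open>As \<open>\<bar>cos \<alpha>\<bar> \<le> 1\<close>, the radius
      \<open>e\<close> survives the division. Moving the centre from \<open>w\<close> to a rational
      \<open>u\<close> costs less than \<open>e / 2\<close>, and \<open>1 / m\<close> fits into the
      rest.\<close>
    obtain m :: nat where m: "m > 0" "inverse m < e / 2"
      using \<open>e > 0\<close> ex_inverse_of_nat_less[of "e / 2"] by auto
    obtain u where u: "u \<in> \<rat>" "w < u" "u < w + e / 2"
      using Rats_dense_in_real[of w "w + e / 2"] \<open>e > 0\<close> by auto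
    have "1 / real m \<le> \<bar>r k * tan \<alpha> - of_int n - u\<bar>" if "k \<ge> 1" for k and n :: int
    proof -
      have "(of_int (-n), r k) \<in> M_of r" using that unfolding M_of_def by blast
      then have "e \<le> dist (\<Phi> \<alpha> (of_int (-n), r k)) z" using z by (meson imageI not_le)
      also have "\<dots> = \<bar>cos \<alpha> * (r k * tan \<alpha> - of_int n - w)\<bar>"
        using False by (simp add: \<Phi>_def w_def dist_real_def tan_def algebra_simps)
      also have "\<dots> = \<bar>cos \<alpha>\<bar> * \<bar>r k * tan \<alpha> - of_int n - w\<bar>" by (rule abs_mult)
      also have "\<dots> \<le> 1 * \<bar>r k * tan \<alpha> - of_int n - w\<bar>"
        by (intro mult_right_mono) auto
      finally have "e \<le> \<bar>r k * tan \<alpha> - of_int n - w\<bar>" by simp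
      then show ?thesis using m(2) u by (simp add: inverse_eq_divide)
    qed
    then have "tan \<alpha> \<in> avoiding r u (1 / real m)" by (simp add: avoiding_def)
    moreover have "\<alpha> = arctan (tan \<alpha>) + of_int j * pi" using j by simp
    ultimately show ?thesis using u(1) m(1)
      by (intro UnI2 UN_I[of "(j, u, m)"]) auto
  qed
qed

lemma countable_E:
  assumes "rising_to_infinity r" "limsup (\<lambda>k. ereal (r (k + 1) - r k)) < \<infinity>"
  shows "countable (E (M_of r))"
proof (rule countable_subset[OF E_subset_avoiding], intro countable_Un countable_UN)
  show "countable ((UNIV :: int set) \<times> (\<rat> :: real set) \<times> {1::nat..})"
    by (intro countable_SIGMA countable_rat) auto
  show "countable (case p of (j, u, m) \<Rightarrow> (\<lambda>t. arctan t + j * pi) ` avoiding r u (1 / real m))"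
    if "p \<in> UNIV \<times> \<rat> \<times> {1..}" for p :: "int \<times> real \<times> nat"
    using that countable_avoiding[OF assms] by auto
qed auto

text \<open>The map \<open>arctan\<close> is 1-Lipschitz, its derivative being at most 1, so it
  carries the null avoiding sets to null sets of angles.\<close>

lemma hausdorff_null_E:
  assumes "rising_to_infinity r" "sublacunary r" "s > 0"
  shows "hausdorff_measure s (E (M_of r)) = 0"
proof (rule hausdorff_null_subset[OF _ E_subset_avoiding], intro hausdorff_null_Un hausdorff_null_UN)
  show "hausdorff_measure s (range (\<lambda>i::int. i * (pi / 2))) = 0"
    using \<open>s > 0\<close> by (intro hausdorff_null_countable) auto
  show "countable ((UNIV :: int set) \<times> (\<rat> :: real set) \<times> {1::nat..})"
    by (intro countable_SIGMA countable_rat) auto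
  fix p :: "int \<times> real \<times> nat" assume p: "p \<in> UNIV \<times> \<rat> \<times> {1..}"
  obtain j u m where jum: "p = (j, u, m)" by (cases p)
  have "1-lipschitz_on (avoiding r u (1 / real m)) (\<lambda>t. arctan t + j * pi)"
  proof (rule lipschitz_onI)
    fix x y :: real
    have "\<bar>arctan x - arctan y\<bar> \<le> \<bar>x - y\<bar>" for x y :: real
    proof -
      have "norm (arctan x - arctan y) \<le> 1 * norm (x - y)"
      proof (rule field_differentiable_bound[of UNIV arctan "\<lambda>x. inverse (1 + x\<^sup>2)"])
        show "(arctan has_field_derivative inverse (1 + z\<^sup>2)) (at z within UNIV)" for z
          using DERIV_arctan[of z] by simp
        show "norm (inverse (1 + z\<^sup>2)) \<le> 1" for z :: real
          by (simp add: inverse_le_1_iff)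
      qed auto
      then show ?thesis by simp
    qed
    then show "dist (arctan x + j * pi) (arctan y + j * pi) \<le> 1 * dist x y"
      by (simp add: dist_real_def)
  qed simp
  then have "hausdorff_measure s ((\<lambda>t. arctan t + j * pi) ` avoiding r u (1 / real m)) = 0"
    using p jum by (intro hausdorff_null_lipschitz_image hausdorff_null_avoiding assms) auto
  then show "hausdorff_measure s (case p of (j, u, m) \<Rightarrow> (\<lambda>t. arctan t + j * pi) ` avoiding r u (1 / real m)) = 0"
    by (simp add: jum)
qed

lemma hausdorff_dim_E_sublacunary:
  assumes "rising_to_infinity r" "sublacunary r"
  shows "hausdorff_dim (E (M_of r)) = 0"
proof -
  have "hausdorff_dim (E (M_of r)) \<le> ennreal 0"
    using hausdorff_null_E[OF assms] by (intro hausdorff_dim_le) auto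
  then show ?thesis by simp
qed

section \<open>A Cantor set for lacunary sequences\<close>

lemma card_int_between:
  fixes x z :: real
  assumes "x - 1 \<le> z"
  shows "finite {p::int. x < p \<and> p < z}" "real (card {p::int. x < p \<and> p < z}) \<le> z - x + 1"
proof -
  have eq: "{p::int. x < p \<and> p < z} = {\<lfloor>x\<rfloor> + 1..\<lceil>z\<rceil> - 1}"
    by (auto simp: less_ceiling_iff floor_less_iff add1_zle_eq)
  show "finite {p::int. x < p \<and> p < z}" unfolding eq by simp
  have "real (card {\<lfloor>x\<rfloor> + 1..\<lceil>z\<rceil> - 1}) = max 0 (of_int (\<lceil>z\<rceil> - \<lfloor>x\<rfloor> - 1))"
    by simp
  also have "\<dots> \<le> z - x + 1"
    using assms by (simp add: max_def) linarith
  finally show "real (card {p::int. x < p \<and> p < z}) \<le> z - x + 1" unfolding eq .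
qed

text \<open>As \<open>u\<close> runs through the unit interval, \<open>y + \<rho> * u\<close> comes
  within \<open>c\<close> of at most \<open>\<rho> + 2\<close> integers. For each of them the
  critical \<open>u\<close> form an interval of length \<open>2 * c / \<rho>\<close>, which meets at
  most \<open>2 * c * B / \<rho> + 2\<close> cells of length \<open>1 / B\<close>.\<close>

lemma card_near_integer:
  fixes c \<rho> y :: real and B :: nat
  assumes "0 < c" "c \<le> 1 / 2" "\<rho> > 0" "B > 0"
  defines "Bad \<equiv> {D::int. 0 \<le> D \<and> D < B \<and>
      (\<exists>u\<in>{D / B..(D + 1) / B}. \<exists>p::int. \<bar>y + \<rho> * u - p\<bar> < c)}"
  shows "finite Bad" "real (card Bad) \<le> (\<rho> + 2) * (2 * c * B / \<rho> + 2)"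
proof -
  define P where "P = {p::int. y - c < p \<and> p < y + \<rho> + c}"
  \<comment> \<open>The \<open>- 1\<close> on the left admits cells that start before the critical
    interval and reach into it.\<close>
  define Q where "Q p = {D::int. B * (p - y - c) / \<rho> - 1 < D \<and> D < B * (p - y + c) / \<rho>}" for p :: int
  have "finite P" and P: "real (card P) \<le> \<rho> + 2"
    using card_int_between[of "y - c" "y + \<rho> + c"] assms(1-3) by (auto simp: P_def)
  have "B * (p - y - c) / \<rho> \<le> B * (p - y + c) / \<rho>" for p :: int
    using assms(1-4) by (intro divide_right_mono mult_left_mono) auto
  then have Q: "finite (Q p)" "real (card (Q p)) \<le> 2 * c * B / \<rho> + 2" for p
    using card_int_between[of "B * (p - y - c) / \<rho> - 1" "B * (p - y + c) / \<rho>"]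
    by (auto simp: Q_def diff_divide_distrib add_divide_distrib algebra_simps)
  have "Bad \<subseteq> (\<Union>p\<in>P. Q p)"
  proof
    fix D assume "D \<in> Bad"
    then obtain u :: real and p :: int where D: "0 \<le> D" "D < B" "D / B \<le> u" "u \<le> (D + 1) / B"
      and p: "\<bar>y + \<rho> * u - p\<bar> < c"
      by (auto simp: Bad_def)
    have u: "D \<le> B * u" "B * u \<le> D + 1"
      using D \<open>B > 0\<close> by (auto simp: field_simps)
    have "0 \<le> D / B" "(D + 1) / B \<le> 1" using D \<open>B > 0\<close> by auto
    then have "0 \<le> u" "u \<le> 1" using D by linarith+
    then have "0 \<le> \<rho> * u" "\<rho> * u \<le> \<rho>"
      using \<open>\<rho> > 0\<close> by (auto simp: mult_le_cancel_left1)
    then have "p \<in> P" using p by (auto simp: P_def abs_less_iff)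
    have "(p - y - c) / \<rho> < u" "u < (p - y + c) / \<rho>"
      using p \<open>\<rho> > 0\<close> by (auto simp: field_simps abs_less_iff)
    then have "B * ((p - y - c) / \<rho>) < B * u" "B * u < B * ((p - y + c) / \<rho>)"
      using \<open>B > 0\<close> by (simp_all only: mult_less_cancel_left_pos of_nat_0_less_iff)
    then have "D \<in> Q p" using u by (auto simp: Q_def)
    then show "D \<in> (\<Union>p\<in>P. Q p)" using \<open>p \<in> P\<close> by blast
  qed
  moreover have fin: "finite (\<Union>p\<in>P. Q p)" using \<open>finite P\<close> Q by blast
  ultimately show "finite Bad" by (rule finite_subset)
  have "card Bad \<le> card (\<Union>p\<in>P. Q p)"
    using \<open>Bad \<subseteq> _\<close> fin by (rule card_mono[rotated])
  also have "\<dots> \<le> (\<Sum>p\<in>P. card (Q p))"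
    using \<open>finite P\<close> by (rule card_UN_le)
  finally have "real (card Bad) \<le> (\<Sum>p\<in>P. real (card (Q p)))"
    by (metis of_nat_le_iff of_nat_sum)
  also have "\<dots> \<le> (\<Sum>p\<in>P. 2 * c * B / \<rho> + 2)"
    by (intro sum_mono Q)
  also have "\<dots> = card P * (2 * c * B / \<rho> + 2)" by simp
  also have "\<dots> \<le> (\<rho> + 2) * (2 * c * B / \<rho> + 2)"
    using P assms(1-4) by (intro mult_right_mono) auto
  finally show "real (card Bad) \<le> (\<rho> + 2) * (2 * c * B / \<rho> + 2)" .
qed

section \<open>Sequences of at least geometric growth\<close>

lemma geometric_growth:
  fixes \<rho> :: "nat \<Rightarrow> real"
  assumes "q > 1" and grow: "\<And>k. k \<ge> K \<Longrightarrow> q * \<rho> k \<le> \<rho> (k + 1)" and "k \<ge> K"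
  shows "q ^ n * \<rho> k \<le> \<rho> (k + n)"
proof (induction n)
  case (Suc n)
  have "q ^ Suc n * \<rho> k = q * (q ^ n * \<rho> k)" by simp
  also have "\<dots> \<le> q * \<rho> (k + n)" using Suc \<open>q > 1\<close> by (intro mult_left_mono) auto
  also have "\<dots> \<le> \<rho> (k + Suc n)" using grow[of "k + n"] \<open>k \<ge> K\<close> by simp
  finally show ?case .
qed simp

text \<open>Read backwards from \<open>n\<close>, the terms are dominated by a geometric series of
  ratio \<open>1 / q\<close>, with sum \<open>q / (q - 1)\<close>.\<close>

lemma sum_geometric_growth:
  fixes \<rho> :: "nat \<Rightarrow> real"
  assumes "q > 1" and grow: "\<And>k. k \<ge> K \<Longrightarrow> \<rho> k > 0 \<and> q * \<rho> k \<le> \<rho> (k + 1)" and "n \<ge> K"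
  shows "(\<Sum>k=K..n. \<rho> k) \<le> \<rho> n * (q / (q - 1))"
  using \<open>n \<ge> K\<close>
proof (induction n rule: dec_induct)
  case base
  have "\<rho> K * 1 \<le> \<rho> K * (q / (q - 1))"
    using grow[of K] \<open>q > 1\<close> by (intro mult_left_mono) auto
  then show ?case by simp
next
  case (step n)
  have "(\<Sum>k=K..Suc n. \<rho> k) \<le> \<rho> n * (q / (q - 1)) + \<rho> (Suc n)"
    using step by simp
  also have "\<rho> n * (q / (q - 1)) = q * \<rho> n * (1 / (q - 1))" by simp
  also have "\<dots> \<le> \<rho> (Suc n) * (1 / (q - 1))"
    using grow[of n] step \<open>q > 1\<close> by (intro mult_right_mono) auto
  also have "\<rho> (Suc n) * (1 / (q - 1)) + \<rho> (Suc n) = \<rho> (Suc n) * (q / (q - 1))"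
    using \<open>q > 1\<close> by (simp add: field_simps)
  finally show ?case by simp
qed

text \<open>From the first to the last index of \<open>T\<close> the sequence grows by less than the
  factor \<open>b\<close>, which leaves room for at most \<open>ln b / ln q\<close> steps; the sum
  is controlled by its last term, below \<open>a * b\<close>.\<close>

lemma geometric_block:
  fixes \<rho> :: "nat \<Rightarrow> real"
  assumes "q > 1" and grow: "\<And>k. k \<ge> K \<Longrightarrow> \<rho> k > 0 \<and> q * \<rho> k \<le> \<rho> (k + 1)"
    and "a > 0" "b \<ge> 1"
  defines "T \<equiv> {k. K \<le> k \<and> a \<le> \<rho> k \<and> \<rho> k < a * b}"
  assumes "finite T"
  shows "real (card T) \<le> 1 + ln b / ln q" "(\<Sum>k\<in>T. \<rho> k) \<le> a * b * (q / (q - 1))"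
proof -
  have "real (card T) \<le> 1 + ln b / ln q \<and> (\<Sum>k\<in>T. \<rho> k) \<le> a * b * (q / (q - 1))"
  proof (cases "T = {}")
    case True
    moreover have "0 \<le> ln b / ln q" "0 \<le> a * b * (q / (q - 1))"
      using assms(1,3,4) by auto
    ultimately show ?thesis by simp
  next
    case False
    define l n where "l = Min T" and "n = Max T"
    have ln: "l \<in> T" "n \<in> T" "\<And>k. k \<in> T \<Longrightarrow> l \<le> k \<and> k \<le> n"
      using False \<open>finite T\<close> by (auto simp: l_def n_def)
    have "l \<le> n" using ln by blast
    then have "card T \<le> n - l + 1"
      using card_mono[of "{l..n}" T] ln(3) by force
    have "q ^ (n - l) * \<rho> l \<le> \<rho> n"
      using geometric_growth[of q K \<rho> l "n - l"] assms(1) grow ln(1) \<open>l \<le> n\<close> by (auto simp: T_def)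
    moreover have "q ^ (n - l) * a \<le> q ^ (n - l) * \<rho> l"
      using ln(1) \<open>q > 1\<close> by (intro mult_left_mono) (auto simp: T_def)
    moreover have "\<rho> n < a * b" using ln(2) by (simp add: T_def)
    ultimately have "a * q ^ (n - l) < a * b" by (simp add: mult.commute)
    then have "q ^ (n - l) \<le> b" using \<open>a > 0\<close> by simp
    then have "ln (q ^ (n - l)) \<le> ln b" using \<open>q > 1\<close> by (intro ln_mono) auto
    then have "real (n - l) * ln q \<le> ln b" using \<open>q > 1\<close> by (simp add: ln_realpow)
    then have "real (n - l) \<le> ln b / ln q" using \<open>q > 1\<close> by (simp add: pos_le_divide_eq)
    then have card: "real (card T) \<le> 1 + ln b / ln q" using \<open>card T \<le> n - l + 1\<close> by linarith
    have "(\<Sum>k\<in>T. \<rho> k) \<le> (\<Sum>k=K..n. \<rho> k)"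
      using ln(3) grow by (intro sum_mono2) (auto simp: T_def intro: less_imp_le)
    also have "\<dots> \<le> \<rho> n * (q / (q - 1))"
      using assms(1) grow ln(2) by (intro sum_geometric_growth) (auto simp: T_def)
    also have "\<dots> \<le> a * b * (q / (q - 1))"
      using ln(2) \<open>q > 1\<close> by (intro mult_right_mono) (auto simp: T_def)
    finally show ?thesis using card by blast
  qed
  then show "real (card T) \<le> 1 + ln b / ln q" "(\<Sum>k\<in>T. \<rho> k) \<le> a * b * (q / (q - 1))" by auto
qed

text \<open>The admissible children, in base \<open>2 * M\<close>, of a node rescaled to the unit
  interval starting at \<open>y\<close>, with \<open>\<rho>\<close> the sequence rescaled
  accordingly. The range of \<open>\<rho> k\<close> spans exactly one factor \<open>2 * M\<close>,
  so each term is dealt with in a single generation.\<close>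

definition cantor_digits :: "nat \<Rightarrow> real \<Rightarrow> real \<Rightarrow> nat \<Rightarrow> (nat \<Rightarrow> real) \<Rightarrow> real \<Rightarrow> int set" where
  "cantor_digits M c a K \<rho> y =
     {D::int. 0 \<le> D \<and> D < 2 * int M - 1 \<and> (\<forall>k\<ge>K. a \<le> \<rho> k \<longrightarrow> \<rho> k < a * (2 * real M) \<longrightarrow>
        (\<forall>u\<in>{D / (2 * real M)..(D + 1) / (2 * real M)}. \<forall>p::int. c \<le> \<bar>\<rho> k * (y + u) - p\<bar>))}"

text \<open>Of the \<open>2 * M - 1\<close> digits at most \<open>M - 1\<close> are bad. The
  constants are fixed before \<open>K\<close>, \<open>\<rho>\<close> and \<open>y\<close>, so the
  same ones serve all nodes and generations.\<close>

lemma cantor_children: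
  fixes q s :: real
  assumes "q > 1" "0 < s" "s < 1"
  shows "\<exists>M c a. M \<ge> 2 \<and> c > 0 \<and> a > 0 \<and> (2 * real M) powr s \<le> M \<and>
    (\<forall>K \<rho> y. (\<forall>k\<ge>K. \<rho> k > 0 \<and> q * \<rho> k \<le> \<rho> (k + 1)) \<longrightarrow>
      finite {k. K \<le> k \<and> a \<le> \<rho> k \<and> \<rho> k < a * (2 * real M)} \<longrightarrow>
      M \<le> card (cantor_digits M c a K \<rho> y))"
proof -
  have "eventually (\<lambda>M::nat. (2 * real M) powr s \<le> M) sequentially"
    using assms by real_asymp
  \<comment> \<open>The bad digits number at most \<open>M / 4 + M / 4 + 4 * L\<close>, where
    \<open>L\<close> is logarithmic in \<open>M\<close>; this condition leaves room for one more
    below \<open>M\<close>.\<close>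
  moreover have "eventually (\<lambda>M::nat. 1 + 4 * (1 + ln (2 * real M) / ln q) \<le> M / 2) sequentially"
    using assms by real_asymp
  moreover have "eventually (\<lambda>M::nat. M \<ge> 2) sequentially"
    by (rule eventually_ge_at_top)
  ultimately have "eventually (\<lambda>M::nat. (2 * real M) powr s \<le> M \<and>
      1 + 4 * (1 + ln (2 * real M) / ln q) \<le> M / 2 \<and> M \<ge> 2) sequentially"
    by eventually_elim auto
  then obtain M :: nat where M: "(2 * real M) powr s \<le> M" "1 + 4 * (1 + ln (2 * real M) / ln q) \<le> M / 2" "M \<ge> 2"
    using eventually_happens'[OF sequentially_bot] by blast
  define L where "L = 1 + ln (2 * real M) / ln q"
  have "ln (2 * real M) / ln q \<ge> 0" using M(3) \<open>q > 1\<close> by simp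
  then have "L \<ge> 1" by (simp add: L_def)
  \<comment> \<open>Makes the sum of \<open>\<rho> k\<close> over a block at most
    \<open>2 * M * (a * (q / (q - 1))) = M / 8\<close>.\<close>
  define a where "a = (q - 1) / (16 * q)"
  have a: "a > 0" "a * (q / (q - 1)) = 1 / 16"
    using \<open>q > 1\<close> by (auto simp: a_def field_simps)
  \<comment> \<open>Makes the terms proportional to \<open>c\<close> contribute at most
    \<open>M / 4\<close> over the at most \<open>L\<close> indices of a block.\<close>
  define c where "c = 1 / (16 * L * (1 + 2 / a))"
  have c: "c > 0" using a \<open>L \<ge> 1\<close> by (simp add: c_def add_pos_nonneg)
  have cL: "c * L * (1 + 2 / a) = 1 / 16"
  proof -
    have "1 + 2 / a > 0" using a by (simp add: add_pos_nonneg)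
    then show ?thesis using \<open>L \<ge> 1\<close> by (simp add: c_def)
  qed
  have "1 \<le> L * (1 + 2 / a)"
    using mult_mono[of 1 L 1 "1 + 2 / a"] \<open>L \<ge> 1\<close> a by simp
  then have "c \<le> 1 / 2"
    unfolding c_def using divide_left_mono[of 8 "16 * L * (1 + 2 / a)" 1] by simp
  show ?thesis
  proof (intro exI conjI allI impI)
    show "M \<ge> 2" "c > 0" "a > 0" "(2 * real M) powr s \<le> M" using M a c by auto
    fix K and \<rho> :: "nat \<Rightarrow> real" and y :: real
    assume "\<forall>k\<ge>K. \<rho> k > 0 \<and> q * \<rho> k \<le> \<rho> (k + 1)"
    then have grow: "\<And>k. k \<ge> K \<Longrightarrow> \<rho> k > 0 \<and> q * \<rho> k \<le> \<rho> (k + 1)" by blast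
    assume fin: "finite {k. K \<le> k \<and> a \<le> \<rho> k \<and> \<rho> k < a * (2 * real M)}"
    define T where "T = {k. K \<le> k \<and> a \<le> \<rho> k \<and> \<rho> k < a * (2 * real M)}"
    have T: "finite T" "real (card T) \<le> L" "(\<Sum>k\<in>T. \<rho> k) \<le> M / 8"
    proof -
      show "finite T" using fin by (simp add: T_def)
      show "real (card T) \<le> L"
        using geometric_block(1)[where q = q and K = K and \<rho> = \<rho> and a = a and b = "2 * real M"] assms(1) grow a(1) M(3) fin by (simp add: T_def L_def)
      have "(\<Sum>k\<in>T. \<rho> k) \<le> a * (2 * real M) * (q / (q - 1))"
        using geometric_block(2)[where q = q and K = K and \<rho> = \<rho> and a = a and b = "2 * real M"] assms(1) grow a(1) M(3) fin by (simp add: T_def)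
      also have "\<dots> = 2 * M * (a * (q / (q - 1)))" by simp
      also have "\<dots> = M / 8" unfolding a(2) by simp
      finally show "(\<Sum>k\<in>T. \<rho> k) \<le> M / 8" .
    qed
    define Bad where "Bad k = {D::int. 0 \<le> D \<and> D < 2 * int M \<and>
      (\<exists>u\<in>{D / (2 * real M)..(D + 1) / (2 * real M)}. \<exists>p::int. \<bar>\<rho> k * y + \<rho> k * u - p\<bar> < c)}" for k
    have Bad: "finite (Bad k)" "real (card (Bad k)) \<le> 2 * \<rho> k + (4 * c * M * (1 + 2 / a) + 4)" if "k \<in> T" for k
    proof -
      have \<rho>: "\<rho> k \<ge> a" "\<rho> k > 0" using that a(1) by (auto simp: T_def)
      show "finite (Bad k)"
        using card_near_integer(1)[OF c \<open>c \<le> 1 / 2\<close> \<rho>(2), of "2 * M" "\<rho> k * y"] M(3) by (simp add: Bad_def)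
      have "real (card (Bad k)) \<le> (\<rho> k + 2) * (2 * c * (2 * M) / \<rho> k + 2)"
        using card_near_integer(2)[OF c \<open>c \<le> 1 / 2\<close> \<rho>(2), of "2 * M" "\<rho> k * y"] M(3) by (simp add: Bad_def)
      also have "\<dots> = 2 * \<rho> k + (4 * c * M * (1 + 2 / \<rho> k) + 4)"
        using \<rho> by (simp add: field_simps)
      also have "\<dots> \<le> 2 * \<rho> k + (4 * c * M * (1 + 2 / a) + 4)"
        using \<rho> a(1) c by (intro add_mono mult_left_mono divide_left_mono) auto
      finally show "real (card (Bad k)) \<le> 2 * \<rho> k + (4 * c * M * (1 + 2 / a) + 4)" .
    qed
    define G where "G = cantor_digits M c a K \<rho> y"
    note G_def' = G_def[unfolded cantor_digits_def]
    have finU: "finite (\<Union>k\<in>T. Bad k)" using T(1) Bad(1) by blast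
    have "{0..<2 * int M - 1} - (\<Union>k\<in>T. Bad k) \<subseteq> G"
    proof
      fix D assume D: "D \<in> {0..<2 * int M - 1} - (\<Union>k\<in>T. Bad k)"
      have "c \<le> \<bar>\<rho> k * (y + u) - p\<bar>" if "k \<ge> K" "a \<le> \<rho> k" "\<rho> k < a * (2 * real M)"
        and u: "u \<in> {D / (2 * real M)..(D + 1) / (2 * real M)}" for k u and p :: int
      proof (rule ccontr)
        assume "\<not> ?thesis"
        then have "\<bar>\<rho> k * y + \<rho> k * u - p\<bar> < c" by (simp add: distrib_left)
        moreover have "0 \<le> D" "D < 2 * int M" using D by auto
        ultimately have "D \<in> Bad k" unfolding Bad_def using u by blast
        moreover have "k \<in> T" using that by (simp add: T_def)
        ultimately show False using D by blast
      qed
      then show "D \<in> G" using D unfolding G_def' by auto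
    qed
    moreover have "finite G"
      by (rule finite_subset[of _ "{0..<2 * int M - 1}"]) (auto simp: G_def')
    ultimately have "card ({0..<2 * int M - 1} - (\<Union>k\<in>T. Bad k)) \<le> card G"
      by (intro card_mono)
    moreover have "card {0..<2 * int M - 1} - card (\<Union>k\<in>T. Bad k) \<le> card ({0..<2 * int M - 1} - (\<Union>k\<in>T. Bad k))"
      by (rule diff_card_le_card_Diff[OF finU])
    moreover have "card {0..<2 * int M - 1} = 2 * M - 1" by simp
    moreover have "real (card (\<Union>k\<in>T. Bad k)) + 1 \<le> M"
    proof -
      have "card (\<Union>k\<in>T. Bad k) \<le> (\<Sum>k\<in>T. card (Bad k))"
        using T(1) by (rule card_UN_le)
      then have "real (card (\<Union>k\<in>T. Bad k)) \<le> (\<Sum>k\<in>T. real (card (Bad k)))"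
        by (metis of_nat_le_iff of_nat_sum)
      also have "\<dots> \<le> (\<Sum>k\<in>T. 2 * \<rho> k + (4 * c * M * (1 + 2 / a) + 4))"
        by (intro sum_mono Bad)
      also have "\<dots> = 2 * (\<Sum>k\<in>T. \<rho> k) + card T * (4 * c * M * (1 + 2 / a) + 4)"
        by (simp add: sum.distrib sum_distrib_left)
      also have "\<dots> \<le> 2 * (M / 8) + L * (4 * c * M * (1 + 2 / a) + 4)"
        using T c a(1) by (intro add_mono mult_left_mono mult_right_mono) auto
      also have "L * (4 * c * M * (1 + 2 / a) + 4) = 4 * M * (c * L * (1 + 2 / a)) + 4 * L"
        by (simp add: algebra_simps)
      also have "4 * M * (c * L * (1 + 2 / a)) = M / 4" by (simp add: cL)
      finally show ?thesis using M(2) by (simp add: L_def)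
    qed
    ultimately show "M \<le> card (cantor_digits M c a K \<rho> y)" unfolding G_def by linarith
  qed
qed

text \<open>The children with the last digit are excluded, so that distinct nodes of the same generation
  are separated. The point at parameter \<open>y\<close> follows the branch given by the base \<open>M\<close> digits of
  \<open>y\<close>.\<close>

lemma cantor_map:
  fixes Ch :: "nat \<Rightarrow> int \<Rightarrow> int set" and M B :: nat
  assumes "M \<ge> 2" "B \<ge> 2" "s > 0" "B powr s \<le> M"
    and Ch: "\<And>j i. Ch j i \<subseteq> {0..<int B - 1}" "\<And>j i. M \<le> card (Ch j i)"
  shows "\<exists>(x :: real \<Rightarrow> real) (v :: real \<Rightarrow> nat \<Rightarrow> int) C. C > 0 \<and>
    (\<forall>y. v y 0 = 0) \<and> (\<forall>y j. v y (Suc j) - B * v y j \<in> Ch j (v y j)) \<and>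
    (\<forall>y j. of_int (v y j) / real B ^ j \<le> x y \<and> x y \<le> (of_int (v y j) + 1) / real B ^ j) \<and>
    (\<forall>y\<in>{0..<1}. \<forall>y'\<in>{0..<1}. \<bar>y - y'\<bar> \<le> C * \<bar>x y - x y'\<bar> powr s)"
proof -
  have fin: "finite (Ch j i)" for j i
    using Ch(1) by (rule finite_subset) simp
  have "\<exists>e. e ` {..<M} \<subseteq> Ch j i \<and> inj_on e {..<M}" for j i
    using card_le_inj[of "{..<M}" "Ch j i"] fin Ch(2) by simp
  then obtain e where e: "\<And>j i. e j i ` {..<M} \<subseteq> Ch j i" "\<And>j i. inj_on (e j i) {..<M}"
    by metis
  \<comment> \<open>The base \<open>M\<close> digit of \<open>y\<close> at place
    \<open>Suc j\<close>; \<open>e\<close> translates it injectively into a child.\<close>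
  define d where "d y j = nat (\<lfloor>real M ^ Suc j * y\<rfloor> - M * \<lfloor>real M ^ j * y\<rfloor>)" for j and y :: real
  have d_int: "0 \<le> \<lfloor>real M ^ Suc j * y\<rfloor> - M * \<lfloor>real M ^ j * y\<rfloor>" "\<lfloor>real M ^ Suc j * y\<rfloor> - M * \<lfloor>real M ^ j * y\<rfloor> < M"
    for j and y :: real
  proof -
    have fl: "of_int \<lfloor>real M ^ j * y\<rfloor> \<le> real M ^ j * y" "real M ^ j * y < of_int \<lfloor>real M ^ j * y\<rfloor> + 1" by linarith+
    have "M * of_int \<lfloor>real M ^ j * y\<rfloor> \<le> M * (real M ^ j * y)" "M * (real M ^ j * y) < M * (of_int \<lfloor>real M ^ j * y\<rfloor> + 1)"
      using fl \<open>M \<ge> 2\<close> by (auto intro!: mult_left_mono mult_strict_left_mono simp del: of_nat_power)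
    then have "of_int (M * \<lfloor>real M ^ j * y\<rfloor>) \<le> real M ^ Suc j * y" "real M ^ Suc j * y < of_int (M * \<lfloor>real M ^ j * y\<rfloor> + M)"
      by (simp_all add: algebra_simps)
    then have "M * \<lfloor>real M ^ j * y\<rfloor> \<le> \<lfloor>real M ^ Suc j * y\<rfloor>" "\<lfloor>real M ^ Suc j * y\<rfloor> < M * \<lfloor>real M ^ j * y\<rfloor> + M"
      by (simp_all only: le_floor_iff floor_less_iff)
    then show "0 \<le> \<lfloor>real M ^ Suc j * y\<rfloor> - M * \<lfloor>real M ^ j * y\<rfloor>" "\<lfloor>real M ^ Suc j * y\<rfloor> - M * \<lfloor>real M ^ j * y\<rfloor> < M"
      by linarith+
  qed
  then have d: "d y j < M" for y j
    by (simp only: d_def nat_less_iff)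
  define v where "v y = rec_nat 0 (\<lambda>j w. B * w + e j w (d y j))" for y
  have v0: "v y 0 = 0" and vS: "v y (Suc j) = B * v y j + e j (v y j) (d y j)" for y j
    by (simp_all add: v_def)
  have child: "v y (Suc j) - B * v y j \<in> Ch j (v y j)" for y j
    using e(1)[of j "v y j"] d[of y j] by (auto simp: vS)
  then have child': "B * v y j \<le> v y (Suc j)" "v y (Suc j) \<le> B * v y j + B - 2" for y j
    using Ch(1)[of j "v y j"] by (fastforce simp: subset_iff)+
  have B: "real B > 0" using \<open>B \<ge> 2\<close> by simp
  define lo hi where "lo y j = of_int (v y j) / real B ^ j" and "hi y j = (of_int (v y j) + 1) / real B ^ j" for y :: real and j
  have step: "lo y j \<le> lo y (Suc j)" "hi y (Suc j) \<le> hi y j - 1 / real B ^ Suc j" for y j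
  proof -
    have "lo y j = of_int (B * v y j) / real B ^ Suc j" using B by (simp add: lo_def)
    also have "\<dots> \<le> lo y (Suc j)" unfolding lo_def
      using child'(1)[of y j] B by (intro divide_right_mono) (simp_all flip: of_int_le_iff[where ?'a = real])
    finally show "lo y j \<le> lo y (Suc j)" .
    have "hi y (Suc j) \<le> (real B * (of_int (v y j) + 1) - 1) / real B ^ Suc j" unfolding hi_def
    proof (intro divide_right_mono)
      have "of_int (v y (Suc j)) \<le> real_of_int (B * v y j + B - 2)"
        using child'(2)[of y j] by (simp only: of_int_le_iff)
      then show "real_of_int (v y (Suc j)) + 1 \<le> real B * (of_int (v y j) + 1) - 1"
        by (simp add: algebra_simps)
    qed simp
    also have "\<dots> = hi y j - 1 / real B ^ Suc j"
      using B by (simp add: hi_def diff_divide_distrib)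
    finally show "hi y (Suc j) \<le> hi y j - 1 / real B ^ Suc j" .
  qed
  have lo_mono: "incseq (lo y)" for y by (rule incseq_SucI) (rule step(1))
  have hi_mono: "decseq (hi y)" for y
  proof (rule decseq_SucI)
    show "hi y (Suc j) \<le> hi y j" for j using step(2)[of y j] B by (smt (verit) zero_le_divide_1_iff zero_le_power)
  qed
  have lo_hi: "lo y i \<le> hi y j" for y i j
  proof -
    have "lo y i \<le> lo y (max i j)" using lo_mono by (simp add: incseqD)
    also have "\<dots> \<le> hi y (max i j)" using B by (simp add: lo_def hi_def divide_right_mono)
    also have "\<dots> \<le> hi y j" using hi_mono by (simp add: decseqD)
    finally show ?thesis .
  qed
  \<comment> \<open>The supremum of the left end points lies in all the nested intervals.\<close>
  define x where "x y = (SUP j. lo y j)" for y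
  have lo_x: "lo y j \<le> x y" for y j
    unfolding x_def by (rule cSUP_upper[OF UNIV_I bdd_aboveI2[OF lo_hi[of y _ 0]]])
  have x_hi: "x y \<le> hi y j" for y j
    unfolding x_def using lo_hi by (intro cSUP_least) auto
  \<comment> \<open>One generation further down, the excluded last digit keeps \<open>x y\<close>
    away from the right end of its interval.\<close>
  have sep: "1 / real B ^ (j + 2) \<le> \<bar>x y - x y'\<bar>" if "v y (Suc j) < v y' (Suc j)" for y y' j
  proof -
    have "hi y (Suc j) \<le> lo y' (Suc j)"
      unfolding hi_def lo_def using that B by (intro divide_right_mono) auto
    then have "x y \<le> x y' - 1 / real B ^ Suc (Suc j)"
      using x_hi[of y "Suc (Suc j)"] step(2)[of y "Suc j"] lo_x[of y' "Suc j"] by linarith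
    then show ?thesis by simp
  qed
  have expand: "\<bar>y - y'\<bar> \<le> (B powr (2 * s)) * \<bar>x y - x y'\<bar> powr s"
    if y: "y \<in> {0..<1}" "y' \<in> {0..<1}" for y y'
  proof (cases "y = y'")
    case False
    define P where "P j \<longleftrightarrow> \<lfloor>real M ^ j * y\<rfloor> = \<lfloor>real M ^ j * y'\<rfloor>" for j
    have P: "\<bar>y - y'\<bar> \<le> 1 / real M ^ j" if "P j" for j
    proof -
      have "\<bar>real M ^ j * y - real M ^ j * y'\<bar> \<le> 1" using that unfolding P_def by linarith
      then have "real M ^ j * \<bar>y - y'\<bar> \<le> 1" by (simp add: abs_mult flip: right_diff_distrib)
      then show ?thesis using \<open>M \<ge> 2\<close> by (simp add: pos_le_divide_eq mult.commute)
    qed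
    obtain n where "(1 / real M) ^ n < \<bar>y - y'\<bar>"
      using real_arch_pow_inv[of "\<bar>y - y'\<bar>" "1 / real M"] False \<open>M \<ge> 2\<close> by auto
    then have "\<not> P n" using P[of n] by (auto simp: power_one_over)
    then have ex: "\<exists>n. \<not> P n" by blast
    have "\<lfloor>y\<rfloor> = 0" "\<lfloor>y'\<rfloor> = 0" using y by (auto simp: floor_eq_iff)
    then have "P 0" by (simp add: P_def)
    \<comment> \<open>\<open>j\<close> is the length of the common initial string of base
      \<open>M\<close> digits: the branches of \<open>y\<close> and \<open>y'\<close> agree up to
      generation \<open>j\<close> and separate in the next.\<close>
    then obtain j where j: "(LEAST n. \<not> P n) = Suc j"
      using LeastI_ex[OF ex] by (cases "LEAST n. \<not> P n") auto
    have nP: "\<not> P (Suc j)" using LeastI_ex[OF ex] j by simp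
    have Pi: "P i" if "i \<le> j" for i
      using not_less_Least[of i "\<lambda>n. \<not> P n"] j that by auto
    have v_eq: "v y i = v y' i" if "i \<le> j" for i
      using that
    proof (induction i)
      case (Suc i)
      then have "P i" "P (Suc i)" using Pi by auto
      then have "d y i = d y' i" by (simp only: P_def d_def)
      then show ?case using Suc by (simp add: vS)
    qed (simp add: v0)
    have "d y j \<noteq> d y' j"
    proof
      assume "d y j = d y' j"
      then have "\<lfloor>real M ^ Suc j * y\<rfloor> - M * \<lfloor>real M ^ j * y\<rfloor> = \<lfloor>real M ^ Suc j * y'\<rfloor> - M * \<lfloor>real M ^ j * y'\<rfloor>"
        using d_int[of j y] d_int[of j y'] unfolding d_def by (simp only: eq_nat_nat_iff)
      then show False using nP Pi[of j] unfolding P_def by simp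
    qed
    then have "v y (Suc j) \<noteq> v y' (Suc j)"
      using v_eq[of j] inj_onD[OF e(2)[of j "v y j"]] d by (auto simp: vS)
    then have "1 / real B ^ (j + 2) \<le> \<bar>x y - x y'\<bar>"
      using sep[of y j y'] sep[of y' j y] by (auto simp: abs_minus_commute neq_iff)
    then have 1: "(1 / real B ^ (j + 2)) powr s \<le> \<bar>x y - x y'\<bar> powr s"
      using B \<open>s > 0\<close> by (intro powr_mono2) auto
    have "\<bar>y - y'\<bar> \<le> 1 / real M ^ j" using P Pi by blast
    also have "\<dots> \<le> 1 / (B powr s) ^ j"
      using assms(4) B \<open>M \<ge> 2\<close> by (intro divide_left_mono power_mono) auto
    \<comment> \<open>The constant \<open>B powr (2 * s)\<close> pays for the two extra generations
      in \<open>sep\<close>.\<close>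
    also have "\<dots> = B powr (2 * s) * (1 / real B ^ (j + 2)) powr s"
    proof -
      have "real B powr (2 * s) = real B powr s * real B powr s"
        by (simp flip: powr_add)
      then have "(1 / real B ^ (j + 2)) powr s = 1 / ((B powr s) ^ j * B powr (2 * s))"
        using B by (simp add: powr_divide powr_mult powr_powr powr_add algebra_simps flip: powr_realpow)
      then show ?thesis using B by simp
    qed
    also have "\<dots> \<le> B powr (2 * s) * \<bar>x y - x y'\<bar> powr s"
      using 1 by (intro mult_left_mono) auto
    finally show ?thesis .
  qed simp
  show ?thesis
    using B v0 child lo_x x_hi expand
    by (intro exI[of _ x] exI[of _ v] exI[of _ "B powr (2 * s)"]) (auto simp: lo_def hi_def)
qed

section \<open>The exceptional set\<close>

text \<open>A dense set is dense in the open interval too, but its finite trace there is already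
  closed.\<close>

lemma not_dense_set_if_finite_Int:
  assumes "a < b" "finite (S \<inter> {a<..<b})"
  shows "\<not> dense_set S"
proof
  assume "dense_set S"
  then have "{a<..<b} \<subseteq> closure ({a<..<b} \<inter> S)"
    using open_Int_closure_subset[of "{a<..<b}" S] by (simp add: dense_set_def)
  also have "\<dots> = {a<..<b} \<inter> S"
    using assms(2) by (intro closure_closed finite_imp_closed) (simp add: Int_commute)
  finally have "finite {a<..<b}" using assms(2) by (metis Int_commute finite_subset)
  then show False using \<open>a < b\<close> by (simp add: infinite_Ioo)
qed

lemma finite_int_affine_bounded:
  fixes g z h :: real
  assumes "g > 0"
  shows "finite {n::int. \<bar>n * g + z\<bar> < h}"
proof (rule finite_subset)
  show "{n::int. \<bar>n * g + z\<bar> < h} \<subseteq> {\<lfloor>(- h - z) / g\<rfloor>..\<lceil>(h - z) / g\<rceil>}"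
  proof
    fix n :: int assume "n \<in> {n::int. \<bar>n * g + z\<bar> < h}"
    then have "- h - z \<le> n * g" "n * g \<le> h - z" by auto
    then have "(- h - z) / g \<le> n" "n \<le> (h - z) / g"
      using assms by (simp_all add: pos_divide_le_eq pos_le_divide_eq)
    then show "n \<in> {\<lfloor>(- h - z) / g\<rfloor>..\<lceil>(h - z) / g\<rceil>}" by simp linarith
  qed
qed simp

lemma \<Phi>_arctan: "\<Phi> (arctan t) (u, v) = cos (arctan t) * (u + v * t)"
proof -
  have "sin (arctan t) = cos (arctan t) * t"
    using tan_arctan[of t] cos_arctan_not_zero[of t] by (simp add: tan_def field_simps)
  then show ?thesis by (simp add: \<Phi>_def algebra_simps)
qed

text \<open>Only the finitely many terms with \<open>k < K\<close> can project near 0, each through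
  finitely many \<open>n\<close>, so the image is not dense. It is not discrete because the
  fractional parts of \<open>r k * t\<close> are pairwise distinct unless \<open>t\<close> is an
  integer divided by a difference of terms.\<close>

lemma arctan_mem_E:
  assumes r: "rising_to_infinity r" and "t \<ge> 0" "c > 0"
    and away: "\<And>k n. k \<ge> K \<Longrightarrow> c \<le> \<bar>r k * t - of_int n\<bar>"
    and "t \<notin> range (\<lambda>(n::int, j, k). of_int n / (r j - r k))"
  shows "arctan t \<in> E (M_of r)"
proof -
  define g where "g = cos (arctan t)"
  have g: "g > 0" unfolding g_def
    using arctan_lbound[of t] arctan_ubound[of t] by (intro cos_gt_zero_pi) auto
  have "arctan t \<in> angles"
  proof -
    have "arctan t < 2 * pi" using arctan_ubound[of t] pi_gt_zero by linarith
    then show ?thesis using \<open>t \<ge> 0\<close> by (simp add: angles_def)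
  qed
  moreover have "\<not> dense_set (\<Phi> (arctan t) ` M_of r)"
  proof (rule not_dense_set_if_finite_Int)
    show "- (g * c) < g * c" using g \<open>c > 0\<close> by simp
    have "\<Phi> (arctan t) ` M_of r \<inter> {- (g * c)<..<g * c} \<subseteq>
        (\<Union>k<K. (\<lambda>n. \<Phi> (arctan t) (of_int n, r k)) ` {n::int. \<bar>n * g + g * (r k * t)\<bar> < g * c})"
    proof
      fix y assume y: "y \<in> \<Phi> (arctan t) ` M_of r \<inter> {- (g * c)<..<g * c}"
      then obtain n :: int and k where nk: "y = \<Phi> (arctan t) (of_int n, r k)"
        by (auto simp: M_of_def)
      have eq: "y = g * (of_int n + r k * t)" by (simp add: nk \<Phi>_arctan g_def)
      have lt: "\<bar>y\<bar> < g * c" using y by auto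
      then have "\<bar>of_int n + r k * t\<bar> < c" using g by (simp add: eq abs_mult)
      then have "\<bar>r k * t - of_int (- n)\<bar> < c" by (simp add: add.commute)
      then have "k < K" using away[of k "- n"] by (meson not_le)
      moreover have "\<bar>n * g + g * (r k * t)\<bar> < g * c"
        using lt unfolding eq by (simp add: algebra_simps)
      ultimately show "y \<in> (\<Union>k<K. (\<lambda>n. \<Phi> (arctan t) (of_int n, r k)) ` {n::int. \<bar>n * g + g * (r k * t)\<bar> < g * c})"
        using nk by blast
    qed
    then show "finite (\<Phi> (arctan t) ` M_of r \<inter> {- (g * c)<..<g * c})"
      by (rule finite_subset) (intro finite_UN_I finite_imageI finite_int_affine_bounded g finite_lessThan)
  qed
  moreover have "\<not> discrete_set (\<Phi> (arctan t) ` M_of r)"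
  proof
    assume "discrete_set (\<Phi> (arctan t) ` M_of r)"
    then have fin: "finite (\<Phi> (arctan t) ` M_of r \<inter> {- 1..1})"
      by (simp add: discrete_set_def)
    \<comment> \<open>This choice of \<open>n\<close> leaves the fractional part of
      \<open>r k * t\<close>, scaled by \<open>g\<close>: infinitely many points in a bounded
      interval.\<close>
    define f where "f k = \<Phi> (arctan t) (of_int (- \<lfloor>r k * t\<rfloor>), r k)" for k
    have f: "f k = g * (r k * t - \<lfloor>r k * t\<rfloor>)" for k by (simp add: f_def \<Phi>_arctan g_def)
    have "f ` {1..} \<subseteq> \<Phi> (arctan t) ` M_of r \<inter> {- 1..1}"
    proof
      fix y assume "y \<in> f ` {1..}"
      then obtain k where k: "k \<ge> 1" "y = f k" by auto
      have "0 \<le> f k" using g by (simp add: f)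
      moreover have "f k \<le> 1 * 1" unfolding f
        using g by (intro mult_mono) (auto simp: g_def, linarith)
      moreover have "(of_int (- \<lfloor>r k * t\<rfloor>), r k) \<in> M_of r"
        using k unfolding M_of_def by blast
      ultimately show "y \<in> \<Phi> (arctan t) ` M_of r \<inter> {- 1..1}" using k by (auto simp: f_def)
    qed
    then have "finite (f ` {1..})" using fin finite_subset by blast
    then have "\<not> inj_on f {1..}" using finite_imageD infinite_Ici by blast
    then obtain j k where jk: "j \<ge> 1" "k \<ge> 1" "j \<noteq> k" "f j = f k"
      by (auto simp: inj_on_def)
    have "r j \<noteq> r k"
      using r jk(1-3) strict_mono_on_imp_inj_on[of "{1..}" r]
      by (auto simp: rising_to_infinity_def inj_on_def)
    moreover have "(r j - r k) * t = of_int (\<lfloor>r j * t\<rfloor> - \<lfloor>r k * t\<rfloor>)"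
    proof -
      have "r j * t - \<lfloor>r j * t\<rfloor> = r k * t - \<lfloor>r k * t\<rfloor>"
        using jk(4) g by (simp add: f)
      then show ?thesis by (simp add: left_diff_distrib)
    qed
    ultimately have "t = of_int (\<lfloor>r j * t\<rfloor> - \<lfloor>r k * t\<rfloor>) / (r j - r k)"
      by (simp add: field_simps)
    then show False using assms(5) by (metis (mono_tags, lifting) case_prod_conv rangeI)
  qed
  ultimately show ?thesis by (simp add: E_def DEN_def DIS_def)
qed

text \<open>On the unit interval the derivative of \<open>arctan\<close> is at least 1/2.\<close>

lemma arctan_expand_ge:
  fixes x y :: real
  assumes "x \<in> {0..1}" "y \<in> {0..1}"
  shows "\<bar>x - y\<bar> \<le> 2 * \<bar>arctan x - arctan y\<bar>"
proof -
  have *: "y - x \<le> 2 * (arctan y - arctan x)" if "0 \<le> x" "x \<le> y" "y \<le> 1" for x y :: real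
  proof -
    have "arctan x - x / 2 \<le> arctan y - y / 2"
    proof (rule DERIV_nonneg_imp_nondecreasing[OF \<open>x \<le> y\<close>])
      fix z assume z: "x \<le> z" "z \<le> y"
      then have "z\<^sup>2 \<le> 1" using that by (intro power_le_one) auto
      then have "inverse 2 \<le> inverse (1 + z\<^sup>2)" by (intro le_imp_inverse_le) (auto simp: add_pos_nonneg)
      moreover have "((\<lambda>z. arctan z - z / 2) has_real_derivative inverse (1 + z\<^sup>2) - 1 / 2) (at z)"
        by (auto intro!: derivative_eq_intros)
      ultimately show "\<exists>d. ((\<lambda>z. arctan z - z / 2) has_real_derivative d) (at z) \<and> 0 \<le> d"
        by (intro exI conjI) auto
    qed
    then show ?thesis by simp
  qed
  show ?thesis using *[of x y] *[of y x] assms by (cases "x \<le> y") auto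
qed

lemma lacunary_growth:
  assumes "rising_to_infinity r" "lacunary r"
  obtains q K where "q > 1" "\<And>k. k \<ge> K \<Longrightarrow> r k > 0 \<and> q * r k \<le> r (k + 1)"
proof -
  obtain q where q: "1 < ereal q" "ereal q < liminf (\<lambda>k. ereal (r (k + 1) / r k))"
    using assms(2) ereal_dense2 unfolding lacunary_def by blast
  have "eventually (\<lambda>k. ereal q < ereal (r (k + 1) / r k)) sequentially"
    using q(2) by (rule less_LiminfD)
  moreover have "eventually (\<lambda>k. r k > 0) sequentially"
    using assms(1) by (auto simp: rising_to_infinity_def filterlim_at_top_dense)
  ultimately have "eventually (\<lambda>k. r k > 0 \<and> q * r k \<le> r (k + 1)) sequentially"
    by eventually_elim (auto simp: pos_less_divide_eq)
  then obtain K where "\<And>k. k \<ge> K \<Longrightarrow> r k > 0 \<and> q * r k \<le> r (k + 1)"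
    unfolding eventually_sequentially by blast
  then show ?thesis using q(1) by (intro that[of q K]) auto
qed

text \<open>The Cantor parametrisation followed by \<open>arctan\<close> is an expanding image of
  the unit interval, hence not null. All its points outside a countable set belong to
  \<open>E (M_of r)\<close>.\<close>

lemma hausdorff_nonnull_E:
  assumes r: "rising_to_infinity r" and "lacunary r" and s: "0 < s" "s < 1"
  shows "hausdorff_measure s (E (M_of r)) \<noteq> 0"
proof -
  obtain q K0 where q: "q > 1" and K0: "\<And>k. k \<ge> K0 \<Longrightarrow> r k > 0 \<and> q * r k \<le> r (k + 1)"
    using lacunary_growth[OF assms(1,2)] by metis
  obtain M c a where M: "M \<ge> 2" and c: "c > 0" and a: "a > 0"
    and Ms: "(2 * real M) powr s \<le> M"
    and digits: "\<And>K \<rho> y. (\<forall>k\<ge>K. \<rho> k > 0 \<and> q * \<rho> k \<le> \<rho> (k + 1)) \<Longrightarrow>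
      finite {k. K \<le> k \<and> a \<le> \<rho> k \<and> \<rho> k < a * (2 * real M)} \<Longrightarrow>
      M \<le> card (cantor_digits M c a K \<rho> y)"
    using cantor_children[OF q s] by auto
  have large: "\<exists>K. \<forall>k\<ge>K. b \<le> r k" for b
    using r by (auto simp: rising_to_infinity_def filterlim_at_top eventually_sequentially)
  \<comment> \<open>Terms below \<open>a\<close> would belong to no generation, so they are left
    out.\<close>
  obtain K1 where K1: "\<And>k. k \<ge> K1 \<Longrightarrow> a \<le> r k" using large by blast
  define K where "K = max K0 K1"
  define B where "B = 2 * M"
  have B: "real B > 1" "real B = 2 * real M" using M by (auto simp: B_def)
  \<comment> \<open>Node \<open>i\<close> of generation \<open>j\<close> starts at
    \<open>i / B ^ j\<close>; at relative position \<open>u\<close> in it, \<open>r k\<close> times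
    the point equals \<open>\<rho> j k * (i + u)\<close>.\<close>
  define \<rho> where "\<rho> j k = r k / real B ^ j" for j k
  define Ch where "Ch j i = cantor_digits M c a K (\<rho> j) (of_int i)" for j and i :: int
  have Ch_card: "M \<le> card (Ch j i)" for j i unfolding Ch_def
  proof (rule digits)
    show "\<forall>k\<ge>K. \<rho> j k > 0 \<and> q * \<rho> j k \<le> \<rho> j (k + 1)"
      using K0 B by (auto simp: \<rho>_def K_def divide_right_mono)
    obtain N where N: "\<forall>k\<ge>N. a * (2 * real M) * real B ^ j \<le> r k" using large by blast
    have "{k. K \<le> k \<and> a \<le> \<rho> j k \<and> \<rho> j k < a * (2 * real M)} \<subseteq> {..<N}"
    proof
      fix k assume k: "k \<in> {k. K \<le> k \<and> a \<le> \<rho> j k \<and> \<rho> j k < a * (2 * real M)}"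
      then have "r k < a * (2 * real M) * real B ^ j"
        using B by (simp add: \<rho>_def pos_divide_less_eq)
      then show "k \<in> {..<N}" using N by (meson lessThan_iff not_le)
    qed
    then show "finite {k. K \<le> k \<and> a \<le> \<rho> j k \<and> \<rho> j k < a * (2 * real M)}"
      by (rule finite_subset) simp
  qed
  have Ch_sub: "Ch j i \<subseteq> {0..<int B - 1}" for j i
    by (auto simp: Ch_def cantor_digits_def B_def)
  have B2: "B \<ge> 2" and Bs: "real B powr s \<le> M" using M Ms by (auto simp: B_def)
  obtain x :: "real \<Rightarrow> real" and v :: "real \<Rightarrow> nat \<Rightarrow> int" and C :: real where x: "C > 0 \<and>
    (\<forall>y. v y 0 = 0) \<and> (\<forall>y j. v y (Suc j) - B * v y j \<in> Ch j (v y j)) \<and>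
    (\<forall>y j. of_int (v y j) / real B ^ j \<le> x y \<and> x y \<le> (of_int (v y j) + 1) / real B ^ j) \<and>
    (\<forall>y\<in>{0..<1}. \<forall>y'\<in>{0..<1}. \<bar>y - y'\<bar> \<le> C * \<bar>x y - x y'\<bar> powr s)"
    using cantor_map[of M B s Ch, OF M B2 s(1) Bs Ch_sub Ch_card] by blast
  then have C: "C > 0" and v0: "\<And>y. v y 0 = 0" and child: "\<And>y j. v y (Suc j) - B * v y j \<in> Ch j (v y j)"
    and lo: "\<And>y j. of_int (v y j) / real B ^ j \<le> x y"
    and hi: "\<And>y j. x y \<le> (of_int (v y j) + 1) / real B ^ j"
    and expand: "\<And>y y'. y \<in> {0..<1} \<Longrightarrow> y' \<in> {0..<1} \<Longrightarrow> \<bar>y - y'\<bar> \<le> C * \<bar>x y - x y'\<bar> powr s"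
    by blast+
  have x01: "x y \<in> {0..1}" for y
    using lo[of y 0] hi[of y 0] by (simp add: v0)
  have away: "c \<le> \<bar>r k * x y - of_int n\<bar>" if "k \<ge> K" for k y and n :: int
  proof -
    have ra: "r k \<ge> a" using K1[of k] that by (simp add: K_def)
    obtain N where "r k / a < real B ^ N" using real_arch_pow[OF B(1)] by blast
    then have ex: "\<exists>N. r k / real B ^ N < a"
      using a B by (intro exI[of _ N]) (simp add: pos_divide_less_eq mult.commute)
    moreover have "\<not> r k / real B ^ 0 < a" using ra by simp
    \<comment> \<open>\<open>j\<close> is the generation responsible for the term
      \<open>r k\<close>, where \<open>a \<le> \<rho> j k < a * B\<close>.\<close>
    ultimately obtain j where j: "(LEAST N. r k / real B ^ N < a) = Suc j"
      using LeastI_ex[OF ex] by (cases "LEAST N. r k / real B ^ N < a") auto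
    have 1: "a \<le> \<rho> j k"
      using not_less_Least[of j "\<lambda>N. r k / real B ^ N < a"] j by (simp add: \<rho>_def)
    have "r k / real B ^ Suc j < a" using LeastI_ex[OF ex] j by simp
    then have 2: "\<rho> j k < a * (2 * real M)"
      using B by (simp add: \<rho>_def field_simps)
    define D where "D = v y (Suc j) - B * v y j"
    define u where "u = real B ^ j * x y - of_int (v y j)"
    have "of_int (v y (Suc j)) \<le> real B ^ Suc j * x y" "real B ^ Suc j * x y \<le> of_int (v y (Suc j)) + 1"
      using lo[of y "Suc j"] hi[of y "Suc j"] B by (simp_all only: pos_divide_le_eq pos_le_divide_eq mult.commute zero_less_power)
    then have "real_of_int D \<le> real B * u" "real B * u \<le> real_of_int D + 1"
      by (simp_all add: D_def u_def algebra_simps)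
    then have "u \<in> {D / (2 * real M)..(D + 1) / (2 * real M)}"
      using B by (simp add: pos_divide_le_eq pos_le_divide_eq mult.commute)
    then have "c \<le> \<bar>\<rho> j k * (of_int (v y j) + u) - of_int n\<bar>"
      using child[of y j] 1 2 that unfolding Ch_def D_def cantor_digits_def by blast
    also have "\<rho> j k * (of_int (v y j) + u) = r k * x y"
      using B by (simp add: \<rho>_def u_def)
    finally show ?thesis .
  qed
  \<comment> \<open>The countably many slopes for which fractional parts of two terms may
    coincide.\<close>
  define Z where "Z = range (\<lambda>(n::int, j, k). of_int n / (r j - r k))"
  have "(\<lambda>y. arctan (x y)) ` {0..<1} \<subseteq> E (M_of r) \<union> arctan ` Z"
  proof
    fix w assume "w \<in> (\<lambda>y. arctan (x y)) ` {0..<1}"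
    then obtain y where y: "w = arctan (x y)" by auto
    show "w \<in> E (M_of r) \<union> arctan ` Z"
    proof (cases "x y \<in> Z")
      case False
      then have "arctan (x y) \<in> E (M_of r)"
        using x01[of y] away c by (intro arctan_mem_E[OF r, of _ c K]) (auto simp: Z_def)
      then show ?thesis using y by simp
    qed (use y in auto)
  qed
  moreover have "hausdorff_measure s (arctan ` Z) = 0"
    using s(1) by (intro hausdorff_null_countable countable_image) (auto simp: Z_def)
  moreover have "hausdorff_measure s ((\<lambda>y. arctan (x y)) ` {0..<1}) \<noteq> 0"
  proof (rule hausdorff_measure_expanding_image_nonzero[of s "C * 2 powr s"])
    fix y y' :: real assume y: "y \<in> {0..<1}" "y' \<in> {0..<1}"
    have "\<bar>x y - x y'\<bar> powr s \<le> (2 * \<bar>arctan (x y) - arctan (x y')\<bar>) powr s"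
      using arctan_expand_ge[OF x01 x01] s(1) by (intro powr_mono2) auto
    also have "\<dots> = 2 powr s * \<bar>arctan (x y) - arctan (x y')\<bar> powr s"
      by (simp add: powr_mult)
    finally have "C * \<bar>x y - x y'\<bar> powr s \<le> C * (2 powr s * \<bar>arctan (x y) - arctan (x y')\<bar> powr s)"
      using C by (intro mult_left_mono) auto
    then show "\<bar>y - y'\<bar> \<le> C * 2 powr s * dist (arctan (x y)) (arctan (x y')) powr s"
      using expand[OF y] by (simp add: dist_real_def mult.assoc)
  qed (use s C in auto)
  ultimately show ?thesis
    using hausdorff_null_Un hausdorff_null_subset by metis
qed

lemma hausdorff_dim_E_lacunary:
  assumes "rising_to_infinity r" "lacunary r"
  shows "hausdorff_dim (E (M_of r)) = 1"
proof (rule antisym)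
  have "bounded (E (M_of r))"
    by (rule bounded_subset[of "{0..2 * pi}"]) (auto simp: E_def angles_def)
  then have "hausdorff_dim (E (M_of r)) \<le> ennreal 1"
    by (intro hausdorff_dim_le hausdorff_null_real_bounded) auto
  then show "hausdorff_dim (E (M_of r)) \<le> 1" by simp
  show "1 \<le> hausdorff_dim (E (M_of r))"
    using hausdorff_nonnull_E[OF assms] by (intro hausdorff_dim_ge_1) auto
qed

theorem proposition5p1:
  fixes r :: "nat \<Rightarrow> real"
  assumes "rising_to_infinity r"
  shows "(lacunary r \<longrightarrow> hausdorff_dim (E (M_of r)) = 1) \<and>
         (sublacunary r \<longrightarrow> hausdorff_dim (E (M_of r)) = 0) \<and>
         (limsup (\<lambda>k. ereal (r (k + 1) - r k)) < \<infinity> \<longrightarrow> countable (E (M_of r)))"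
  using hausdorff_dim_E_lacunary[OF assms] hausdorff_dim_E_sublacunary[OF assms] countable_E[OF assms]
  by blast

end
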